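(* Let $q\in L^\infty(0,1)$, and write $q=\nu'$ with $\nu\in L^\infty(0,1)$ (so in particular $\nu\in L^2(0,1)$). Let $\mathcal{L}$ be the Dirichlet Sturm–Liouville operator $\mathcal{L}y=-y''+q(x)y$ on $(0,1)$, $y(0)=y(1)=0$. Fix $T>0$. For any $k\in\mathbb{R}$, if the initial data satisfy $(u_0,u_1)\in W^{1+k}_{\mathcal{L}}\times W^{k}_{\mathcal{L}}$, then the problem $$\partial_t^2u(t,x)+\mathcal{L}u(t,x)=0,\quad (t,x)\in[0,T]\times(0,1),$$ $$u(0,x)=u_0(x),\quad \partial_tu(0,x)=u_1(x),\quad x\in(0,1),\qquad u(t,0)=0=u(t,1),\quad t\in[0,T],$$ has a unique solution $u\in C([0,T],W^{1+k}_{\mathcal{L}})\cap C^1([0,T],W^{k}_{\mathcal{L}})$, and for all $t\in[0,T]$ the following estimates hold: $$\|u(t,\cdot)\|^2_{L^2}\lesssim \|u_0\|^2_{L^2}+\|u_1\|^2_{W^{-1}_{\mathcal{L}}},$$ $$\|\partial_tu(t,\cdot)\|^2_{L^2}\lesssim \|u_0\|^2_{W^1_{\mathcal{L}}}+\|u_1\|^2_{L^2},$$ $$\|\partial_xu(t,\cdot)\|^2_{L^2}\lesssim (1+\|\nu\|^2_{L^2})\left(\|u_0\|^2_{W^1_{\mathcal{L}}}+\|u_1\|^2_{L^2}\right)+\|\nu\|^2_{L^\infty}\left(\|u_0\|^2_{L^2}+\|u_1\|^2_{W^{-1}_{\mathcal{L}}}\right),$$ $$\|\partial_x^2u(t,\cdot)\|^2_{L^2}\lesssim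 \|q\|^2_{L^\infty}\left(\|u_0\|^2_{L^2}+\|u_1\|^2_{W^{-1}_{\mathcal{L}}}\right)+\|u_0\|^2_{W^2_{\mathcal{L}}}+\|u_1\|^2_{W^1_{\mathcal{L}}},$$ $$\|u(t,\cdot)\|^2_{W^k_{\mathcal{L}}}\lesssim \|u_0\|^2_{W^k_{\mathcal{L}}}+\|u_1\|^2_{W^{k-1}_{\mathcal{L}}},$$ where the implicit constants are independent of $u_0$, $u_1$ and $q$.
   Context: The operator $\mathcal{L}$ (Dirichlet conditions on $(0,1)$) has eigenvalues $\lambda_n=(\pi n)^2(1+o(n^{-1}))$, $n=1,2,\dots$, which are positive, and eigenfunctions that, after $L^2$-normalisation, form an orthonormal basis $\{\phi_n\}$ of $L^2(0,1)$. Powers $\mathcal{L}^s$, $s\in\mathbb{R}$, are defined spectrally: $\mathcal{L}^s f=\sum_n\lambda_n^s\langle f,\phi_n\rangle\phi_n$. Test functions: $C^\infty_{\mathcal{L}}(0,1)=\bigcap_{m\ge1}\mathrm{Dom}(\mathcal{L}^m)$ with the Fréchet topology given by the norms $\max_{j\le m}\|\mathcal{L}^j\phi\|_{L^2}$; $\mathcal{D}'_{\mathcal{L}}(0,1)$ is the space of continuous linear functionals on $C^\infty_{\mathcal{L}}(0,1)$. For $k\in\mathbb{R}$, $W^k_{\mathcal{L}}=\{f\in\mathcal{D}'_{\mathcal{L}}(0,1):\mathcal{L}^{k/2}f\in L^2(0,1)\}$ with norm $\|f\|_{W^k_{\mathcal{L}}}=\|\mathcal{L}^{k/2}f\|_{L^2}$.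 The space $C^n([0,T],W^k_{\mathcal{L}})$ carries the norm $\max_{0\le t\le T}\sum_{j=0}^n\|\partial_t^jf(t,\cdot)\|_{W^k_{\mathcal{L}}}$. The notation $A\lesssim B$ means $A\le CB$ for a constant $C$. *)

theory Defs
  imports "HOL-Analysis.Analysis"
begin

definition sq_int :: "(real \<Rightarrow> real) \<Rightarrow> bool" where
  "sq_int f \<longleftrightarrow> set_borel_measurable lborel {0..1} f
     \<and> set_integrable lborel {0..1} (\<lambda>x. (f x)^2)"

definition L2_inner :: "(real \<Rightarrow> real) \<Rightarrow> (real \<Rightarrow> real) \<Rightarrow> real" where
  "L2_inner f g = (LINT x:{0..1}|lborel. f x * g x)"

definition L2_norm :: "(real \<Rightarrow> real) \<Rightarrow> real" where
  "L2_norm f = sqrt (LINT x:{0..1}|lborel. (f x)^2)"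

definition Linf :: "(real \<Rightarrow> real) \<Rightarrow> bool" where
  "Linf f \<longleftrightarrow> set_borel_measurable lborel {0..1} f
     \<and> (\<exists>B. AE x in lborel. x \<in> {0..1} \<longrightarrow> \<bar>f x\<bar> \<le> B)"

definition Linf_norm :: "(real \<Rightarrow> real) \<Rightarrow> real" where
  "Linf_norm f = Inf {B. AE x in lborel. x \<in> {0..1} \<longrightarrow> \<bar>f x\<bar> \<le> B}"

text \<open>phi is a Dirichlet eigenfunction of L y = -y'' + q y with eigenvalue lam:
  phi is C^1 on [0,1], phi' is absolutely continuous with phi'' = (q - lam) phi a.e.,
  and phi(0) = phi(1) = 0.\<close>
definition dirichlet_eigenfun :: "(real \<Rightarrow> real) \<Rightarrow> real \<Rightarrow> (real \<Rightarrow> real) \<Rightarrow> bool" where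
  "dirichlet_eigenfun q lam phi \<longleftrightarrow>
     (\<exists>dphi. (\<forall>x\<in>{0..1}. (phi has_real_derivative dphi x) (at x within {0..1}))
        \<and> (\<forall>x\<in>{0..1}. dphi x = dphi 0 + (LINT s:{0..x}|lborel. (q s - lam) * phi s)))
     \<and> phi 0 = 0 \<and> phi 1 = 0"

definition eigen_ONB :: "(real \<Rightarrow> real) \<Rightarrow> (nat \<Rightarrow> real) \<Rightarrow> (nat \<Rightarrow> real \<Rightarrow> real) \<Rightarrow> bool" where
  "eigen_ONB q lam phi \<longleftrightarrow>
     (\<forall>n. dirichlet_eigenfun q (lam n) (phi n) \<and> sq_int (phi n))
     \<and> (\<forall>m n. L2_inner (phi m) (phi n) = (if m = n then 1 else 0))
     \<and> (\<forall>f. sq_int f \<longrightarrow> (\<lambda>n. (L2_inner f (phi n))^2) sums (L2_norm f)^2)"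

definition coeff :: "(nat \<Rightarrow> real \<Rightarrow> real) \<Rightarrow> (real \<Rightarrow> real) \<Rightarrow> nat \<Rightarrow> real" where
  "coeff phi f n = L2_inner f (phi n)"

text \<open>C^\<infinity>_L = intersection of the Dom(L^m); Dom(L^m) defined spectrally.\<close>
definition test_fun :: "(nat \<Rightarrow> real) \<Rightarrow> (nat \<Rightarrow> real \<Rightarrow> real) \<Rightarrow> (real \<Rightarrow> real) \<Rightarrow> bool" where
  "test_fun lam phi psi \<longleftrightarrow> sq_int psi
     \<and> (\<forall>m::nat. summable (\<lambda>n. (lam n)^(2*m) * (coeff phi psi n)^2))"

text \<open>The seminorm max_{j \<le> m} ||L^j psi||_{L^2}, with ||L^j psi|| computed spectrally.\<close>
definition test_seminorm :: "(nat \<Rightarrow> real) \<Rightarrow> (nat \<Rightarrow> real \<Rightarrow> real) \<Rightarrow> nat \<Rightarrow> (real \<Rightarrow> real) \<Rightarrow> real" where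
  "test_seminorm lam phi m psi =
     Max ((\<lambda>j. sqrt (\<Sum>n. (lam n)^(2*j) * (coeff phi psi n)^2)) ` {0..m})"

definition L_distr :: "(nat \<Rightarrow> real) \<Rightarrow> (nat \<Rightarrow> real \<Rightarrow> real) \<Rightarrow> ((real \<Rightarrow> real) \<Rightarrow> real) \<Rightarrow> bool" where
  "L_distr lam phi F \<longleftrightarrow>
     (\<forall>psi1 psi2 a b. test_fun lam phi psi1 \<and> test_fun lam phi psi2 \<longrightarrow>
        F (\<lambda>x. a * psi1 x + b * psi2 x) = a * F psi1 + b * F psi2)
     \<and> (\<exists>m C. \<forall>psi. test_fun lam phi psi \<longrightarrow> \<bar>F psi\<bar> \<le> C * test_seminorm lam phi m psi)"

text \<open>g is an L^2 representative of L^s F, where (L^s F)(psi) = F(L^s psi) and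
  L^s psi is the (test) function with coefficients lam n powr s * coeff psi n.\<close>
definition Lpow_rep :: "(nat \<Rightarrow> real) \<Rightarrow> (nat \<Rightarrow> real \<Rightarrow> real) \<Rightarrow> real \<Rightarrow> ((real \<Rightarrow> real) \<Rightarrow> real)
     \<Rightarrow> (real \<Rightarrow> real) \<Rightarrow> bool" where
  "Lpow_rep lam phi s F g \<longleftrightarrow> sq_int g
     \<and> (\<forall>psi chi. test_fun lam phi psi \<and> test_fun lam phi chi
          \<and> (\<forall>n. coeff phi chi n = lam n powr s * coeff phi psi n)
          \<longrightarrow> F chi = L2_inner g psi)"

definition W_L :: "(nat \<Rightarrow> real) \<Rightarrow> (nat \<Rightarrow> real \<Rightarrow> real) \<Rightarrow> real \<Rightarrow> ((real \<Rightarrow> real) \<Rightarrow> real) \<Rightarrow> bool" where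
  "W_L lam phi k F \<longleftrightarrow> L_distr lam phi F \<and> (\<exists>g. Lpow_rep lam phi (k/2) F g)"

definition W_norm :: "(nat \<Rightarrow> real) \<Rightarrow> (nat \<Rightarrow> real \<Rightarrow> real) \<Rightarrow> real \<Rightarrow> ((real \<Rightarrow> real) \<Rightarrow> real) \<Rightarrow> real" where
  "W_norm lam phi k F = L2_norm (SOME g. Lpow_rep lam phi (k/2) F g)"

definition distr_eq :: "(nat \<Rightarrow> real) \<Rightarrow> (nat \<Rightarrow> real \<Rightarrow> real) \<Rightarrow> ((real \<Rightarrow> real) \<Rightarrow> real)
     \<Rightarrow> ((real \<Rightarrow> real) \<Rightarrow> real) \<Rightarrow> bool" where
  "distr_eq lam phi F G \<longleftrightarrow> (\<forall>psi. test_fun lam phi psi \<longrightarrow> F psi = G psi)"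

text \<open>u \<in> C([0,T], W^{1+k}_L) \<inter> C^1([0,T], W^k_L) with time derivative du, solving
  u_tt + L u = 0 in D'_L (tested against every test function psi, with
  (L u)(psi) = u(L psi)), and u(0) = u0, u_t(0) = u1. Dirichlet boundary conditions
  are encoded in the operator L / the spaces W_L.\<close>
definition wave_solution :: "(nat \<Rightarrow> real) \<Rightarrow> (nat \<Rightarrow> real \<Rightarrow> real) \<Rightarrow> real \<Rightarrow> real
     \<Rightarrow> ((real \<Rightarrow> real) \<Rightarrow> real) \<Rightarrow> ((real \<Rightarrow> real) \<Rightarrow> real)
     \<Rightarrow> (real \<Rightarrow> (real \<Rightarrow> real) \<Rightarrow> real) \<Rightarrow> (real \<Rightarrow> (real \<Rightarrow> real) \<Rightarrow> real) \<Rightarrow> bool" where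
  "wave_solution lam phi T k u0 u1 u du \<longleftrightarrow>
     (\<forall>t\<in>{0..T}. W_L lam phi (1 + k) (u t) \<and> W_L lam phi k (du t))
     \<and> (\<forall>t\<in>{0..T}. ((\<lambda>s. W_norm lam phi (1 + k) (\<lambda>psi. u s psi - u t psi)) \<longlongrightarrow> 0)
                      (at t within {0..T}))
     \<and> (\<forall>t\<in>{0..T}. ((\<lambda>s. W_norm lam phi k (\<lambda>psi. (u s psi - u t psi) / (s - t) - du t psi)) \<longlongrightarrow> 0)
                      (at t within {0..T}))
     \<and> (\<forall>t\<in>{0..T}. ((\<lambda>s. W_norm lam phi k (\<lambda>psi. du s psi - du t psi)) \<longlongrightarrow> 0)
                      (at t within {0..T}))
     \<and> (\<forall>psi chi. test_fun lam phi psi \<and> test_fun lam phi chi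
          \<and> (\<forall>n. coeff phi chi n = lam n * coeff phi psi n) \<longrightarrow>
          (\<forall>t\<in>{0..T}. ((\<lambda>s. du s psi) has_real_derivative (- u t chi)) (at t within {0..T})))
     \<and> distr_eq lam phi (u 0) u0 \<and> distr_eq lam phi (du 0) u1"

end

(*
  Expanding in the eigenbasis turns the equation into the oscillators a_n'' + lambda_n a_n = 0, so
  u(t) has the coefficients cos(sqrt lambda_n t) u0_n + sin(sqrt lambda_n t) / sqrt lambda_n u1_n.
  All Sobolev norms are weighted l^2 norms of the coefficients F(phi_n), which gives the spectral
  estimates; the spaces W^s are nested because the positive eigenvalues cannot accumulate at 0.
  For u_x one uses |w'|^2 = <L w, w> - <q w, w> with <q w, w> = - 2 <nu w, w'>, absorbing |w'|^2 / 2 by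
  Young's inequality, and for u_xx the identity w'' = q w - L w.
*)
theory Submission
  imports Defs
begin

section \<open>The space of square integrable functions on the unit interval\<close>

text \<open>The hypotheses provide an eigenbasis with positive eigenvalues but no asymptotics, so a
  positive lower bound for the spectrum has to be derived. It comes from counting. For finitely many
  eigenfunctions with eigenvalues at most M, the kernel given by the sum of the phi_n(x)^2 has
  integral equal to their number, while the energy bounds its supremum; so only finitely many
  eigenvalues lie below any M.

  The obstacle for u_x and u_xx is that an eigenfunction series may not be differentiated term by
  term: the phi_n' are not orthogonal. Energy identities are therefore proved for finite
  combinations only. Applied to blocks of the series they give a Cauchy criterion, completeness of
  L^2 yields a limit of the derivatives, and the representative of u(t) is defined as the primitive
  of that limit. It is recognised as u(t) by its coefficients, which are continuous under L^2
  convergence.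

  Functionals matter only on test functions, and \<open>W_norm\<close> picks some representative.
  Both ambiguities disappear once a distribution is replaced by its coefficient sequence.\<close>

lemma square_add_le: "(x + y)\<^sup>2 \<le> 2 * (x\<^sup>2 + y\<^sup>2)" for x y :: real
  using zero_le_power2[of "x - y"] by (simp add: power2_eq_square algebra_simps)

lemma square_diff_le: "(x - y)\<^sup>2 \<le> 2 * (x\<^sup>2 + y\<^sup>2)" for x y :: real
  using square_add_le[of x "- y"] by simp

text \<open>Riesz-Fischer: a subsequence whose consecutive squared distances are below 4^-k
  converges almost everywhere, and Fatou's lemma carries the Cauchy estimate over to the
  limit.\<close>

lemma square_integrable_complete:
  fixes f :: "nat \<Rightarrow> 'a \<Rightarrow> real"
  assumes "finite_measure M"
    and meas[measurable]: "\<And>n. f n \<in> borel_measurable M"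
    and int: "\<And>n. integrable M (\<lambda>x. (f n x)\<^sup>2)"
    and Cauchy: "\<And>e. e > 0 \<Longrightarrow> \<exists>N. \<forall>m\<ge>N. \<forall>n\<ge>N. (\<integral>x. (f m x - f n x)\<^sup>2 \<partial>M) < e"
  obtains g where "g \<in> borel_measurable M" "integrable M (\<lambda>x. (g x)\<^sup>2)"
    "(\<lambda>n. \<integral>x. (f n x - g x)\<^sup>2 \<partial>M) \<longlonglongrightarrow> 0"
proof -
  interpret finite_measure M by fact
  have int_diff: "integrable M (\<lambda>x. (f m x - f n x)\<^sup>2)" for m n
  proof (rule Bochner_Integration.integrable_bound)
    show "integrable M (\<lambda>x. 2 * (f m x)\<^sup>2 + 2 * (f n x)\<^sup>2)"
      using int by auto
    show "AE x in M. norm ((f m x - f n x)\<^sup>2) \<le> norm (2 * (f m x)\<^sup>2 + 2 * (f n x)\<^sup>2)"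
      using square_diff_le[of "f m _" "f n _"] by (auto intro!: AE_I2 simp: distrib_left)
  qed measurable
  have "\<exists>N. \<forall>m\<ge>N. \<forall>n\<ge>N. (\<integral>x. (f m x - f n x)\<^sup>2 \<partial>M) < (1/4)^k" for k :: nat
    by (rule Cauchy) simp
  then obtain N where N: "\<And>k m n. m \<ge> N k \<Longrightarrow> n \<ge> N k \<Longrightarrow> (\<integral>x. (f m x - f n x)\<^sup>2 \<partial>M) < (1/4)^k"
    by metis
  \<comment> \<open>Partial sums of \<open>N\<close> make \<open>r k\<close> at least every
    \<open>N j\<close> with j <= k, so \<open>r k\<close> and \<open>r (Suc k)\<close> both lie
    beyond \<open>N k\<close>.\<close>
  define r where "r k = (\<Sum>i\<le>k. N i)" for k
  have r_ge: "r k \<ge> N j" if "k \<ge> j" for k j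
    unfolding r_def using that by (intro member_le_sum) auto
  define d where "d k x = \<bar>f (r (Suc k)) x - f (r k) x\<bar>" for k x
  have [measurable]: "d k \<in> borel_measurable M" for k
    unfolding d_def by measurable
  have d_bound: "(\<integral>\<^sup>+x. ennreal (d k x) \<partial>M) \<le> ennreal ((1/2)^k * (1 + measure M (space M)))" for k
  proof -
    \<comment> \<open>Young's inequality with weight 2^k trades the L^2 bound 4^-k for an L^1 bound:
      after integration over the finite measure both terms are of order 2^-k.\<close>
    have sq: "d k x \<le> 2^k * (d k x)\<^sup>2 + (1/2)^k" for x
    proof -
      have "0 \<le> (2^k * d k x - 1)\<^sup>2 / 2^k + d k x"
        by (simp add: d_def)
      also have "\<dots> = 2^k * (d k x)\<^sup>2 + (1/2)^k - d k x"
        by (simp add: field_simps power2_eq_square)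
      finally show ?thesis by simp
    qed
    have d2: "integrable M (\<lambda>x. (d k x)\<^sup>2)" "(\<integral>x. (d k x)\<^sup>2 \<partial>M) \<le> (1/4)^k"
      using int_diff[of "r (Suc k)" "r k"] N[of k "r (Suc k)" "r k"] r_ge[of k "Suc k"] r_ge[of k k]
      by (auto simp: d_def)
    have "(\<integral>\<^sup>+x. ennreal (d k x) \<partial>M) \<le> (\<integral>\<^sup>+x. ennreal (2^k * (d k x)\<^sup>2 + (1/2)^k) \<partial>M)"
      using sq by (intro nn_integral_mono ennreal_leI) auto
    also have "\<dots> = ennreal (\<integral>x. 2^k * (d k x)\<^sup>2 + (1/2)^k \<partial>M)"
      using d2 by (intro nn_integral_eq_integral) auto
    also have "(\<integral>x. 2^k * (d k x)\<^sup>2 + (1/2)^k \<partial>M) = 2^k * (\<integral>x. (d k x)\<^sup>2 \<partial>M) + (1/2)^k * measure M (space M)"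
      using d2 by simp
    also have "\<dots> \<le> 2^k * (1/4)^k + (1/2)^k * measure M (space M)"
      using d2 by simp
    also have "2^k * (1/4)^k = (1/2::real)^k"
      by (simp flip: power_mult_distrib)
    also have "(1/2::real)^k + (1/2)^k * measure M (space M) = (1/2)^k * (1 + measure M (space M))"
      by (simp add: algebra_simps)
    finally show ?thesis by (simp add: ennreal_leI)
  qed
  have "(\<integral>\<^sup>+x. (\<Sum>k. ennreal (d k x)) \<partial>M) = (\<Sum>k. \<integral>\<^sup>+x. ennreal (d k x) \<partial>M)"
    by (intro nn_integral_suminf) measurable
  also have "\<dots> \<le> (\<Sum>k. ennreal ((1/2)^k * (1 + measure M (space M))))"
    by (intro suminf_le d_bound) auto
  also have "\<dots> < \<infinity>"
    by (subst suminf_ennreal2) (auto intro!: summable_mult2 summable_geometric)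
  finally have "AE x in M. (\<Sum>k. ennreal (d k x)) \<noteq> \<infinity>"
    by (intro nn_integral_PInf_AE) auto
  then have "AE x in M. summable (\<lambda>k. d k x)"
    by (rule AE_mp) (auto intro!: AE_I2 summable_suminf_not_top simp: d_def)
  define g where "g x = lim (\<lambda>k. f (r k) x)" for x
  have [measurable]: "g \<in> borel_measurable M"
    unfolding g_def by measurable
  have lim_AE: "AE x in M. (\<lambda>k. f (r k) x) \<longlonglongrightarrow> g x"
    using \<open>AE x in M. summable (\<lambda>k. d k x)\<close>
  proof (rule AE_mp, intro AE_I2 impI)
    fix x assume "summable (\<lambda>k. d k x)"
    then have "summable (\<lambda>k. f (r (Suc k)) x - f (r k) x)"
      unfolding d_def by (rule summable_rabs_cancel)
    then have "(\<lambda>n. \<Sum>k<n. f (r (Suc k)) x - f (r k) x) \<longlonglongrightarrow> (\<Sum>k. f (r (Suc k)) x - f (r k) x)"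
      by (rule summable_LIMSEQ)
    then have "(\<lambda>n. f (r n) x - f (r 0) x) \<longlonglongrightarrow> (\<Sum>k. f (r (Suc k)) x - f (r k) x)"
      by (subst (asm) sum_lessThan_telescope)
    then have "(\<lambda>n. f (r n) x - f (r 0) x + f (r 0) x) \<longlonglongrightarrow> (\<Sum>k. f (r (Suc k)) x - f (r k) x) + f (r 0) x"
      by (intro tendsto_intros)
    then have "convergent (\<lambda>n. f (r n) x)"
      by (auto simp: convergent_def)
    then show "(\<lambda>k. f (r k) x) \<longlonglongrightarrow> g x"
      by (simp add: g_def convergent_LIMSEQ_iff)
  qed
  \<comment> \<open>Fatou along the subsequence, with \<open>n\<close> fixed and \<open>g\<close> as
    the almost everywhere limit.\<close>
  have bound: "(\<integral>\<^sup>+x. ennreal ((f n x - g x)\<^sup>2) \<partial>M) \<le> ennreal ((1/4)^j)" if "n \<ge> N j" for n j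
  proof -
    have "(\<integral>\<^sup>+x. ennreal ((f n x - g x)\<^sup>2) \<partial>M) = (\<integral>\<^sup>+x. liminf (\<lambda>k. ennreal ((f n x - f (r k) x)\<^sup>2)) \<partial>M)"
    proof (rule nn_integral_cong_AE, use lim_AE in \<open>rule AE_mp\<close>, intro AE_I2 impI)
      fix x assume "(\<lambda>k. f (r k) x) \<longlonglongrightarrow> g x"
      then have "(\<lambda>k. ennreal ((f n x - f (r k) x)\<^sup>2)) \<longlonglongrightarrow> ennreal ((f n x - g x)\<^sup>2)"
        by (intro tendsto_intros) auto
      then show "ennreal ((f n x - g x)\<^sup>2) = liminf (\<lambda>k. ennreal ((f n x - f (r k) x)\<^sup>2))"
        by (metis lim_imp_Liminf sequentially_bot)
    qed
    also have "\<dots> \<le> liminf (\<lambda>k. \<integral>\<^sup>+x. ennreal ((f n x - f (r k) x)\<^sup>2) \<partial>M)"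
      by (intro nn_integral_liminf) measurable
    also have "\<dots> = liminf (\<lambda>k. ennreal (\<integral>x. (f n x - f (r k) x)\<^sup>2 \<partial>M))"
      by (simp add: nn_integral_eq_integral int_diff)
    also have "\<dots> \<le> ennreal ((1/4)^j)"
    proof (rule Liminf_le)
      show "\<forall>\<^sub>F k in sequentially. ennreal (\<integral>x. (f n x - f (r k) x)\<^sup>2 \<partial>M) \<le> ennreal ((1/4)^j)"
        using N[of j n] r_ge that
        by (intro eventually_sequentiallyI[of j] ennreal_leI) (auto intro: less_imp_le)
    qed simp
    finally show ?thesis .
  qed
  have int_g: "integrable M (\<lambda>x. (f n x - g x)\<^sup>2)" if "n \<ge> N 0" for n
  proof (rule integrableI_bounded)
    show "(\<integral>\<^sup>+x. ennreal (norm ((f n x - g x)\<^sup>2)) \<partial>M) < \<infinity>"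
      using le_less_trans[OF bound[OF that] ennreal_less_top] by simp
  qed measurable
  have le: "(\<integral>x. (f n x - g x)\<^sup>2 \<partial>M) \<le> (1/4)^j" if "n \<ge> N 0" "n \<ge> N j" for n j
    using bound[OF that(2)] nn_integral_eq_integral[OF int_g[OF that(1)]] by simp
  show ?thesis
  proof
    show "integrable M (\<lambda>x. (g x)\<^sup>2)"
    proof (rule Bochner_Integration.integrable_bound)
      show "integrable M (\<lambda>x. 2 * (f (N 0) x)\<^sup>2 + 2 * (f (N 0) x - g x)\<^sup>2)"
        using int int_g by auto
      show "AE x in M. norm ((g x)\<^sup>2) \<le> norm (2 * (f (N 0) x)\<^sup>2 + 2 * (f (N 0) x - g x)\<^sup>2)"
      proof (intro AE_I2)
        show "norm ((g x)\<^sup>2) \<le> norm (2 * (f (N 0) x)\<^sup>2 + 2 * (f (N 0) x - g x)\<^sup>2)" for x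
          using square_diff_le[of "f (N 0) x" "f (N 0) x - g x"] by simp
      qed
    qed measurable
    show "(\<lambda>n. \<integral>x. (f n x - g x)\<^sup>2 \<partial>M) \<longlonglongrightarrow> 0"
    proof (rule LIMSEQ_I)
      fix e :: real assume "e > 0"
      then obtain j where j: "(1/4)^j < e"
        using real_arch_pow_inv[of e "1/4"] by auto
      have "norm ((\<integral>x. (f n x - g x)\<^sup>2 \<partial>M) - 0) < e" if "n \<ge> max (N 0) (N j)" for n
        using le[of n j] that j by simp
      then show "\<exists>no. \<forall>n\<ge>no. norm ((\<integral>x. (f n x - g x)\<^sup>2 \<partial>M) - 0) < e"
        by blast
    qed
  qed fact
qed

text \<open>Restricting the measure turns the set integrals of the definitions into plain integrals
  over a finite measure.\<close>

abbreviation unit_interval :: "real measure" where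
  "unit_interval \<equiv> restrict_space lborel {0..1}"

lemma finite_measure_unit_interval: "finite_measure unit_interval"
  by (rule finite_measureI) (simp add: space_restrict_space emeasure_restrict_space)

interpretation unit_interval: finite_measure unit_interval
  by (rule finite_measure_unit_interval)

lemma set_borel_measurable_unit_interval:
  "set_borel_measurable lborel {0..1} f \<longleftrightarrow> f \<in> borel_measurable unit_interval"
  for f :: "real \<Rightarrow> real"
  unfolding set_borel_measurable_def
  by (subst borel_measurable_restrict_space_iff) (auto simp: mult.commute)

lemma set_integrable_unit_interval:
  "set_integrable lborel {0..1} f \<longleftrightarrow> integrable unit_interval f" for f :: "real \<Rightarrow> real"
  unfolding set_integrable_def by (subst integrable_restrict_space) auto

lemma set_integral_unit_interval:
  "(LINT x:{0..1}|lborel. f x) = integral\<^sup>L unit_interval f" for f :: "real \<Rightarrow> real"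
  unfolding set_lebesgue_integral_def by (subst integral_restrict_space) auto

lemmas unit_interval_simps =
  set_borel_measurable_unit_interval set_integrable_unit_interval set_integral_unit_interval

lemma sq_int_iff:
  "sq_int f \<longleftrightarrow> f \<in> borel_measurable unit_interval \<and> integrable unit_interval (\<lambda>x. (f x)\<^sup>2)"
  by (simp add: sq_int_def unit_interval_simps)

lemma sq_int_measurable[measurable_dest]: "sq_int f \<Longrightarrow> f \<in> borel_measurable unit_interval"
  by (simp add: sq_int_iff)

lemma sq_int_mult_integrable:
  assumes "sq_int f" "sq_int g"
  shows "integrable unit_interval (\<lambda>x. f x * g x)"
proof (rule Bochner_Integration.integrable_bound)
  show "integrable unit_interval (\<lambda>x. (f x)\<^sup>2 + (g x)\<^sup>2)"
    using assms by (auto simp: sq_int_iff)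
  have "\<bar>a * b\<bar> \<le> a\<^sup>2 + b\<^sup>2" for a b :: real
  proof -
    have "2 * \<bar>a * b\<bar> \<le> a\<^sup>2 + b\<^sup>2"
      using sum_squares_bound[of "\<bar>a\<bar>" "\<bar>b\<bar>"] by (simp add: abs_mult)
    then show ?thesis by linarith
  qed
  then show "AE x in unit_interval. norm (f x * g x) \<le> norm ((f x)\<^sup>2 + (g x)\<^sup>2)"
    by (auto intro!: AE_I2)
  show "(\<lambda>x. f x * g x) \<in> borel_measurable unit_interval"
    using assms by measurable
qed

lemma sq_int_const: "sq_int (\<lambda>x. c)"
  by (simp add: sq_int_iff)

lemma sq_int_integrable: "sq_int f \<Longrightarrow> integrable unit_interval f"
  using sq_int_mult_integrable[of f "\<lambda>x. 1"] sq_int_const by simp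

lemma sq_int_add:
  assumes "sq_int f" "sq_int g"
  shows "sq_int (\<lambda>x. f x + g x)"
proof -
  have "(f x + g x)\<^sup>2 = (f x)\<^sup>2 + (g x)\<^sup>2 + 2 * (f x * g x)" for x
    by (simp add: power2_sum)
  then show ?thesis
    using assms sq_int_mult_integrable[OF assms] by (auto simp: sq_int_iff)
qed

lemma sq_int_cmult: "sq_int f \<Longrightarrow> sq_int (\<lambda>x. c * f x)"
  by (auto simp: sq_int_iff power_mult_distrib)

lemma sq_int_diff: "sq_int f \<Longrightarrow> sq_int g \<Longrightarrow> sq_int (\<lambda>x. f x - g x)"
  using sq_int_add[of f "\<lambda>x. (-1) * g x"] sq_int_cmult[of g "-1"] by simp

lemma sq_int_sum: "(\<And>i. i \<in> A \<Longrightarrow> sq_int (f i)) \<Longrightarrow> sq_int (\<lambda>x. \<Sum>i\<in>A. f i x)"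
  by (induction A rule: infinite_finite_induct) (auto intro: sq_int_add sq_int_const)

text \<open>With \<open>f\<close> the constant 1 this also covers bounded functions themselves:
  continuous ones, indicators and members of L^infinity.\<close>

lemma sq_int_bounded_mult:
  assumes "g \<in> borel_measurable unit_interval" "AE x in unit_interval. \<bar>g x\<bar> \<le> B" "sq_int f"
  shows "sq_int (\<lambda>x. g x * f x)"
  unfolding sq_int_iff
proof
  show meas: "(\<lambda>x. g x * f x) \<in> borel_measurable unit_interval"
    using assms by measurable
  show "integrable unit_interval (\<lambda>x. (g x * f x)\<^sup>2)"
  proof (rule Bochner_Integration.integrable_bound)
    show "integrable unit_interval (\<lambda>x. B\<^sup>2 * (f x)\<^sup>2)"
      using assms by (simp add: sq_int_iff)
    show "AE x in unit_interval. norm ((g x * f x)\<^sup>2) \<le> norm (B\<^sup>2 * (f x)\<^sup>2)"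
      using assms(2) by (rule AE_mp) (auto intro!: AE_I2 mult_right_mono abs_le_square_iff[THEN iffD1]
        simp: power_mult_distrib)
  qed (use meas in measurable)
qed

lemma continuous_measurable_unit_interval:
  fixes f :: "real \<Rightarrow> real"
  assumes "continuous_on {0..1} f"
  shows "f \<in> borel_measurable unit_interval"
  by (metis assms borel_measurable_continuous_on_restrict measurable_cong_sets
      sets_lborel sets_restrict_space_cong)

lemma continuous_sq_int:
  assumes "continuous_on {0..1} f"
  shows "sq_int f"
proof -
  obtain B where "\<And>x. x \<in> {0..1} \<Longrightarrow> \<bar>f x\<bar> \<le> B"
    using compact_imp_bounded[OF compact_continuous_image[OF assms compact_Icc]]
    by (force simp: bounded_iff)
  then have "AE x in unit_interval. \<bar>f x\<bar> \<le> B"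
    by (auto intro!: AE_I2 simp: space_restrict_space)
  from sq_int_bounded_mult[OF continuous_measurable_unit_interval[OF assms] this sq_int_const[of 1]]
  show ?thesis by simp
qed

section \<open>Inner product and norm of L^2(0,1)\<close>

lemma L2_inner_eq: "L2_inner f g = (\<integral>x. f x * g x \<partial>unit_interval)"
  by (simp add: L2_inner_def unit_interval_simps)

lemma L2_norm_square: "(L2_norm f)\<^sup>2 = (\<integral>x. (f x)\<^sup>2 \<partial>unit_interval)"
  by (simp add: L2_norm_def unit_interval_simps)

lemma L2_norm_nonneg: "0 \<le> L2_norm f"
  by (simp add: L2_norm_def unit_interval_simps)

lemma L2_norm_inner: "(L2_norm f)\<^sup>2 = L2_inner f f"
  by (simp only: L2_norm_square L2_inner_eq power2_eq_square[of "f _"])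

lemma L2_inner_commute: "L2_inner f g = L2_inner g f"
  by (simp add: L2_inner_eq mult.commute)

lemma L2_inner_cong:
  "(\<And>x. x \<in> {0..1} \<Longrightarrow> f x = f' x) \<Longrightarrow> (\<And>x. x \<in> {0..1} \<Longrightarrow> g x = g' x) \<Longrightarrow> L2_inner f g = L2_inner f' g'"
  unfolding L2_inner_eq
  by (intro Bochner_Integration.integral_cong) (auto simp: space_restrict_space)

lemma L2_inner_add_left:
  "sq_int f \<Longrightarrow> sq_int g \<Longrightarrow> sq_int h \<Longrightarrow> L2_inner (\<lambda>x. f x + g x) h = L2_inner f h + L2_inner g h"
  by (simp add: L2_inner_eq sq_int_mult_integrable distrib_right)

lemma L2_inner_diff_left:
  "sq_int f \<Longrightarrow> sq_int g \<Longrightarrow> sq_int h \<Longrightarrow> L2_inner (\<lambda>x. f x - g x) h = L2_inner f h - L2_inner g h"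
  by (simp add: L2_inner_eq sq_int_mult_integrable left_diff_distrib)

lemma L2_inner_cmult_left: "L2_inner (\<lambda>x. c * f x) h = c * L2_inner f h"
  by (simp add: L2_inner_eq mult.assoc)

lemma L2_inner_sum_left:
  assumes "\<And>i. i \<in> A \<Longrightarrow> sq_int (f i)" "sq_int h"
  shows "L2_inner (\<lambda>x. \<Sum>i\<in>A. f i x) h = (\<Sum>i\<in>A. L2_inner (f i) h)"
  by (simp add: L2_inner_eq sum_distrib_right sq_int_mult_integrable assms)

lemma L2_norm_square_add:
  assumes "sq_int f" "sq_int g"
  shows "(L2_norm (\<lambda>x. f x + g x))\<^sup>2 = (L2_norm f)\<^sup>2 + 2 * L2_inner f g + (L2_norm g)\<^sup>2"
proof -
  have "L2_inner f (\<lambda>x. f x + g x) = L2_inner f f + L2_inner g f"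
    "L2_inner g (\<lambda>x. f x + g x) = L2_inner f g + L2_inner g g"
    using assms by (simp_all add: L2_inner_commute[of _ "\<lambda>x. f x + g x"] L2_inner_add_left)
  then show ?thesis
    using assms by (simp add: L2_norm_inner L2_inner_add_left sq_int_add L2_inner_commute[of g f])
qed

lemma L2_norm_cmult: "L2_norm (\<lambda>x. c * f x) = \<bar>c\<bar> * L2_norm f"
  by (simp add: L2_norm_def unit_interval_simps power_mult_distrib real_sqrt_mult)

text \<open>Discriminant argument for the nonnegative polynomial t -> |f + t g|^2. It is of degree
  at most 1 when \<open>g\<close> has norm 0, hence the case split.\<close>

lemma L2_Cauchy_Schwarz:
  assumes "sq_int f" "sq_int g"
  shows "\<bar>L2_inner f g\<bar> \<le> L2_norm f * L2_norm g"
proof -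
  have quadratic: "0 \<le> (L2_norm f)\<^sup>2 + 2 * t * L2_inner f g + t\<^sup>2 * (L2_norm g)\<^sup>2" for t
    using L2_norm_square_add[OF assms(1) sq_int_cmult[OF assms(2), of t]]
      zero_le_power2[of "L2_norm (\<lambda>x. f x + t * g x)"]
    by (simp add: L2_inner_commute[of f "\<lambda>x. t * g x"] L2_inner_cmult_left L2_norm_cmult
        power_mult_distrib L2_inner_commute[of g f])
  have "(L2_inner f g)\<^sup>2 \<le> (L2_norm f)\<^sup>2 * (L2_norm g)\<^sup>2"
  proof (cases "L2_norm g = 0")
    case True
    have "L2_inner f g = 0"
    proof (rule ccontr)
      assume "L2_inner f g \<noteq> 0"
      then show False
        \<comment> \<open>At this \<open>t\<close> the polynomial, now affine, takes the value
          -1.\<close>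
        using quadratic[of "- ((L2_norm f)\<^sup>2 + 1) / (2 * L2_inner f g)"] True by (simp add: field_simps)
    qed
    then show ?thesis by simp
  next
    case False
    then have "0 \<le> ((L2_norm f)\<^sup>2 * (L2_norm g)\<^sup>2 - (L2_inner f g)\<^sup>2) / (L2_norm g)\<^sup>2"
      \<comment> \<open>The minimiser of the quadratic.\<close>
      using quadratic[of "- L2_inner f g / (L2_norm g)\<^sup>2"]
      by (simp add: field_simps power2_eq_square)
    then show ?thesis
      using False by (simp add: zero_le_divide_iff)
  qed
  then have "\<bar>L2_inner f g\<bar>\<^sup>2 \<le> (L2_norm f * L2_norm g)\<^sup>2"
    by (simp add: power_mult_distrib)
  then show ?thesis
    by (rule power2_le_imp_le) (simp add: L2_norm_nonneg)
qed

lemma L2_norm_triangle: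
  assumes "sq_int f" "sq_int g"
  shows "L2_norm (\<lambda>x. f x + g x) \<le> L2_norm f + L2_norm g"
proof (rule power2_le_imp_le)
  show "(L2_norm (\<lambda>x. f x + g x))\<^sup>2 \<le> (L2_norm f + L2_norm g)\<^sup>2"
    using L2_norm_square_add[OF assms] L2_Cauchy_Schwarz[OF assms] by (simp add: power2_sum)
qed (simp add: L2_norm_nonneg)

lemma L2_norm_triangle_diff:
  assumes "sq_int f" "sq_int g"
  shows "\<bar>L2_norm f - L2_norm g\<bar> \<le> L2_norm (\<lambda>x. f x - g x)"
proof -
  have "L2_norm (\<lambda>x. g x - f x) = L2_norm (\<lambda>x. f x - g x)"
    using L2_norm_cmult[of "-1" "\<lambda>x. f x - g x"] by simp
  then show ?thesis
    using L2_norm_triangle[of g "\<lambda>x. f x - g x"] L2_norm_triangle[of f "\<lambda>x. g x - f x"] assms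
    by (auto simp: sq_int_diff)
qed

text \<open>The interval has length 1, so a uniform bound is an L^2 bound with the same
  constant.\<close>

lemma L2_norm_le_bound:
  assumes "sq_int f" "\<And>x. x \<in> {0..1} \<Longrightarrow> \<bar>f x\<bar> \<le> B"
  shows "L2_norm f \<le> B"
proof (rule power2_le_imp_le)
  show "0 \<le> B" using assms(2)[of 0] by simp
  have "(\<integral>x. (f x)\<^sup>2 \<partial>unit_interval) \<le> (\<integral>x. B\<^sup>2 \<partial>unit_interval)"
    using assms by (intro integral_mono)
      (auto simp: sq_int_iff space_restrict_space abs_le_square_iff[symmetric] \<open>0 \<le> B\<close>)
  also have "\<dots> = B\<^sup>2"
    by (simp add: measure_restrict_space space_restrict_space)
  finally show "(L2_norm f)\<^sup>2 \<le> B\<^sup>2"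
    by (simp add: L2_norm_square)
qed

lemma L2_complete:
  assumes "\<And>n. sq_int (f n)"
    and "\<And>e. e > 0 \<Longrightarrow> \<exists>N. \<forall>m\<ge>N. \<forall>n\<ge>N. (L2_norm (\<lambda>x. f m x - f n x))\<^sup>2 < e"
  obtains g where "sq_int g" "(\<lambda>n. L2_norm (\<lambda>x. f n x - g x)) \<longlonglongrightarrow> 0"
proof -
  obtain g where g: "g \<in> borel_measurable unit_interval" "integrable unit_interval (\<lambda>x. (g x)\<^sup>2)"
    "(\<lambda>n. \<integral>x. (f n x - g x)\<^sup>2 \<partial>unit_interval) \<longlonglongrightarrow> 0"
    using square_integrable_complete[OF finite_measure_unit_interval, of f] assms
    by (auto simp: sq_int_iff L2_norm_square)
  from tendsto_real_sqrt[OF g(3)] have "(\<lambda>n. L2_norm (\<lambda>x. f n x - g x)) \<longlonglongrightarrow> 0"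
    by (simp add: L2_norm_def unit_interval_simps)
  with g show ?thesis
    using that by (auto simp: sq_int_iff)
qed

section \<open>Primitives and integration by parts\<close>

text \<open>This is the integral through which \<open>dirichlet_eigenfun\<close> and the theorem
  express absolute continuity.\<close>

definition primitive :: "(real \<Rightarrow> real) \<Rightarrow> real \<Rightarrow> real" where
  "primitive g x = (LINT s:{0..x}|lborel. g s)"

lemma sq_int_indicator: "sq_int (indicator {a..b})"
proof -
  have "indicator {a..b} \<in> borel_measurable unit_interval"
    by (intro measurable_restrict_space1) auto
  then show ?thesis
    by (rule sq_int_bounded_mult[of "indicator {a..b}" 1 "\<lambda>x. 1", simplified])
       (auto intro!: AE_I2 sq_int_const simp: indicator_def)
qed

text \<open>As an inner product with an indicator, the primitive inherits linearity and the
  Cauchy-Schwarz bound.\<close>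

lemma primitive_eq: "x \<in> {0..1} \<Longrightarrow> primitive g x = L2_inner (indicator {0..x}) g"
  unfolding primitive_def set_lebesgue_integral_def L2_inner_def
  by (intro Bochner_Integration.integral_cong) (auto simp: indicator_def)

lemma primitive_1: "primitive g 1 = integral\<^sup>L unit_interval g"
  by (simp add: primitive_def set_integral_unit_interval)

lemma primitive_0: "primitive g 0 = 0"
proof -
  have "AE s in lborel. indicator {0..0::real} s *\<^sub>R g s = 0"
    using AE_lborel_singleton[of "0::real"] by (rule AE_mp) (auto intro!: AE_I2)
  then show ?thesis
    unfolding primitive_def set_lebesgue_integral_def by (intro integral_eq_zero_AE) auto
qed

text \<open>The one-dimensional Sobolev inequality. It lifts L^2 convergence of derivatives to
  convergence of the functions, and bounds the eigenfunction kernel pointwise.\<close>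

lemma primitive_le_L2_norm:
  assumes "sq_int g" "x \<in> {0..1}"
  shows "\<bar>primitive g x\<bar> \<le> L2_norm g"
proof -
  have "L2_norm (indicator {0..x}) \<le> 1"
    by (rule L2_norm_le_bound) (auto simp: sq_int_indicator indicator_def)
  then have "L2_norm (indicator {0..x}) * L2_norm g \<le> 1 * L2_norm g"
    by (intro mult_right_mono L2_norm_nonneg)
  then show ?thesis
    using L2_Cauchy_Schwarz[OF sq_int_indicator assms(1), of 0 x] assms(2) by (simp add: primitive_eq)
qed

lemma continuous_primitive:
  assumes "sq_int g"
  shows "continuous_on {0..1} (primitive g)"
proof -
  have "set_integrable lborel {0..1} g"
    using assms by (simp add: unit_interval_simps sq_int_integrable)
  then have *: "set_integrable lborel {0..x} g" if "x \<in> {0..1}" for x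
    by (rule set_integrable_subset) (use that in auto)
  have "primitive g x = integral {0..x} g" if "x \<in> {0..1}" for x
    unfolding primitive_def using set_borel_integral_eq_integral(2)[OF *[OF that]] .
  moreover have "continuous_on {0..1} (\<lambda>x. integral {0..x} g)"
    using set_borel_integral_eq_integral(1)[OF *[of 1]] by (intro indefinite_integral_continuous_1) auto
  ultimately show ?thesis
    by (subst continuous_on_cong[OF refl]) auto
qed

lemma sq_int_primitive: "sq_int g \<Longrightarrow> sq_int (primitive g)"
  by (rule continuous_sq_int[OF continuous_primitive])

lemma primitive_diff:
  "sq_int f \<Longrightarrow> sq_int g \<Longrightarrow> x \<in> {0..1} \<Longrightarrow> primitive (\<lambda>s. f s - g s) x = primitive f x - primitive g x"
  by (simp add: primitive_eq L2_inner_commute[of "indicator {0..x}"] L2_inner_diff_left sq_int_indicator)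

lemma primitive_add:
  "sq_int f \<Longrightarrow> sq_int g \<Longrightarrow> x \<in> {0..1} \<Longrightarrow> primitive (\<lambda>s. f s + g s) x = primitive f x + primitive g x"
  by (simp add: primitive_eq L2_inner_commute[of "indicator {0..x}"] L2_inner_add_left sq_int_indicator)

lemma primitive_cmult: "x \<in> {0..1} \<Longrightarrow> primitive (\<lambda>s. c * f s) x = c * primitive f x"
  by (simp add: primitive_eq L2_inner_commute[of "indicator {0..x}"] L2_inner_cmult_left)

lemma primitive_sum:
  "(\<And>i. i \<in> A \<Longrightarrow> sq_int (f i)) \<Longrightarrow> x \<in> {0..1} \<Longrightarrow>
    primitive (\<lambda>s. \<Sum>i\<in>A. f i s) x = (\<Sum>i\<in>A. primitive (f i) x)"
  by (simp add: primitive_eq L2_inner_commute[of "indicator {0..x}"] L2_inner_sum_left sq_int_indicator)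

lemma primitive_cong:
  "(\<And>s. s \<in> {0..1} \<Longrightarrow> f s = g s) \<Longrightarrow> x \<in> {0..1} \<Longrightarrow> primitive f x = primitive g x"
  by (auto simp: primitive_eq intro: L2_inner_cong)

lemma primitive_derivative:
  assumes "\<And>x. x \<in> {0..1} \<Longrightarrow> (f has_real_derivative f' x) (at x within {0..1})"
    and "continuous_on {0..1} f'" "x \<in> {0..1}"
  shows "primitive f' x = f x - f 0"
  unfolding primitive_def set_lebesgue_integral_def
proof (rule integral_FTC_atLeastAtMost)
  show "continuous_on {0..x} f'"
    using assms by (auto elim: continuous_on_subset)
  show "(f has_vector_derivative f' y) (at y within {0..x})" if "0 \<le> y" "y \<le> x" for y
    using assms(1)[of y] assms(3) that
    by (auto simp: has_real_derivative_iff_has_vector_derivative intro: has_vector_derivative_within_subset)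
qed (use assms in auto)

lemma AE_unit_interval: "(AE x in unit_interval. P x) \<longleftrightarrow> (AE x in lborel. x \<in> {0..1} \<longrightarrow> P x)"
  by (subst AE_restrict_space_iff) auto

text \<open>Fubini on the unit square: each inner product integrates g(s) k(x) over one of the two
  triangles cut off by the diagonal, and the right-hand side is the integral over the whole
  square.\<close>

lemma integration_by_parts_primitive:
  assumes g: "sq_int g" and k: "sq_int k"
  shows "L2_inner g (primitive k) + L2_inner k (primitive g) = primitive g 1 * primitive k 1"
proof -
  interpret pair_sigma_finite unit_interval unit_interval ..
  have [measurable]: "g \<in> borel_measurable unit_interval" "k \<in> borel_measurable unit_interval"
    using g k by measurable
  have [measurable]: "(\<lambda>x. x) \<in> borel_measurable unit_interval"
    by (simp add: continuous_measurable_unit_interval)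
  \<comment> \<open>The integrand g(s) k(x) on the triangle s <= x.\<close>
  define h where "h = (\<lambda>x s. k x * (g s * (if s \<le> x then 1 else 0 :: real)))"
  have h_meas: "case_prod h \<in> borel_measurable (unit_interval \<Otimes>\<^sub>M unit_interval)"
    unfolding h_def by measurable
  have k_int: "integrable unit_interval (\<lambda>x. k x * (if P x then 1 else 0))"
    if "Measurable.pred unit_interval P" for P
    by (rule Bochner_Integration.integrable_bound[OF sq_int_integrable[OF k]])
       (use that in \<open>auto intro!: AE_I2\<close>)
  have h_int: "integrable (unit_interval \<Otimes>\<^sub>M unit_interval) (case_prod h)"
  proof (rule Bochner_Integration.integrable_bound)
    show "integrable (unit_interval \<Otimes>\<^sub>M unit_interval) (\<lambda>p. k (fst p) * g (snd p))"
      by (rule Fubini_integrable)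
         (auto simp: abs_mult intro!: AE_I2 sq_int_integrable[OF g] sq_int_integrable[OF k] integrable_mult_left)
    show "AE p in unit_interval \<Otimes>\<^sub>M unit_interval. norm (case_prod h p) \<le> norm (k (fst p) * g (snd p))"
      by (auto simp: h_def intro!: AE_I2)
  qed (rule h_meas)
  have inner: "L2_inner (indicator {0..x}) f = (\<integral>s. f s * (if s \<le> x then 1 else 0) \<partial>unit_interval)" for x f
    unfolding L2_inner_eq
    by (intro Bochner_Integration.integral_cong) (auto simp: space_restrict_space)
  have "L2_inner k (primitive g) = (\<integral>x. (\<integral>s. h x s \<partial>unit_interval) \<partial>unit_interval)"
    unfolding L2_inner_eq
    by (intro Bochner_Integration.integral_cong) (auto simp: space_restrict_space primitive_eq inner h_def)
  also have "\<dots> = (\<integral>s. (\<integral>x. h x s \<partial>unit_interval) \<partial>unit_interval)"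
    by (rule Fubini_integral[OF h_int, symmetric])
  also have "\<dots> = (\<integral>s. g s * (\<integral>x. k x * (if s \<le> x then 1 else 0) \<partial>unit_interval) \<partial>unit_interval)"
    by (simp add: h_def mult.left_commute[of "k _"])
  also have "\<dots> = (\<integral>s. primitive k 1 * g s - g s * primitive k s \<partial>unit_interval)"
  proof (intro Bochner_Integration.integral_cong refl)
    fix s assume "s \<in> space unit_interval"
    then have s: "s \<in> {0..1}" by (simp add: space_restrict_space)
    have "primitive k s + (\<integral>x. k x * (if s \<le> x then 1 else 0) \<partial>unit_interval)
      = (\<integral>x. k x * (if x \<le> s then 1 else 0) + k x * (if s \<le> x then 1 else 0) \<partial>unit_interval)"
      using s by (subst Bochner_Integration.integral_add) (auto intro!: k_int simp: primitive_eq inner)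
    also have "\<dots> = (\<integral>x. k x \<partial>unit_interval)"
    proof (rule integral_cong_AE)
      \<comment> \<open>The two half-intervals overlap in the single point \<open>s\<close>, a null
        set.\<close>
      have "AE x in unit_interval. x \<noteq> s"
        using AE_lborel_singleton[of s] unfolding AE_unit_interval by (rule AE_mp) auto
      then show "AE x in unit_interval. k x * (if x \<le> s then 1 else 0) + k x * (if s \<le> x then 1 else 0) = k x"
        by (rule AE_mp) (auto intro!: AE_I2)
    qed measurable
    finally show "g s * (\<integral>x. k x * (if s \<le> x then 1 else 0) \<partial>unit_interval)
      = primitive k 1 * g s - g s * primitive k s"
      by (simp add: primitive_1 algebra_simps flip: distrib_left)
  qed
  also have "\<dots> = primitive k 1 * primitive g 1 - L2_inner g (primitive k)"
    using g k by (subst Bochner_Integration.integral_diff)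
      (auto intro: sq_int_integrable sq_int_mult_integrable[OF g sq_int_primitive[OF k]] simp: primitive_1 L2_inner_eq)
  finally show ?thesis by simp
qed


section \<open>Essentially bounded multipliers\<close>

lemma not_AE_unit_interval_False: "\<not> (AE x in unit_interval. False)"
  by (simp add: eventually_False ae_filter_eq_bot_iff emeasure_restrict_space space_restrict_space)

text \<open>The infimum is itself an essential bound, because the exceptional sets for Inf + 1/(n+1)
  are countably many null sets.\<close>

lemma Linf_AE_bound:
  assumes "Linf f"
  shows "AE x in unit_interval. \<bar>f x\<bar> \<le> Linf_norm f"
proof -
  define S where "S = {B. AE x in lborel. x \<in> {0..1} \<longrightarrow> \<bar>f x\<bar> \<le> B}"
  have "S \<noteq> {}"
    using assms unfolding Linf_def S_def by blast
  have "AE x in unit_interval. \<bar>f x\<bar> \<le> Inf S + 1 / real (Suc n)" for n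
  proof -
    obtain B where B: "B \<in> S" "B < Inf S + 1 / real (Suc n)"
      using cInf_lessD[OF \<open>S \<noteq> {}\<close>, of "Inf S + 1 / real (Suc n)"] by auto
    from B(1) have "AE x in unit_interval. \<bar>f x\<bar> \<le> B"
      by (simp only: S_def mem_Collect_eq AE_unit_interval)
    then show ?thesis
      by (rule AE_mp) (use B(2) in \<open>auto intro!: AE_I2\<close>)
  qed
  then have "AE x in unit_interval. \<forall>n. \<bar>f x\<bar> \<le> Inf S + 1 / real (Suc n)"
    by (subst AE_all_countable) auto
  then show ?thesis
  proof (rule AE_mp, intro AE_I2 impI)
    fix x assume *: "\<forall>n. \<bar>f x\<bar> \<le> Inf S + 1 / real (Suc n)"
    have "(\<lambda>n. Inf S + 1 / real (Suc n)) \<longlonglongrightarrow> Inf S + 0"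
      using LIMSEQ_inverse_real_of_nat by (intro tendsto_intros) (simp add: inverse_eq_divide)
    from LIMSEQ_le_const[OF this, of "\<bar>f x\<bar>"] * show "\<bar>f x\<bar> \<le> Linf_norm f"
      by (auto simp: Linf_norm_def S_def)
  qed
qed

lemma Linf_norm_nonneg:
  assumes "Linf f"
  shows "Linf_norm f \<ge> 0"
proof (rule ccontr)
  assume "\<not> Linf_norm f \<ge> 0"
  then have "AE x in unit_interval. False"
    using Linf_AE_bound[OF assms] by (elim AE_mp) (auto intro!: AE_I2)
  then show False
    by (simp add: not_AE_unit_interval_False)
qed

lemma Linf_measurable: "Linf f \<Longrightarrow> f \<in> borel_measurable unit_interval"
  by (simp add: Linf_def unit_interval_simps)

lemma sq_int_Linf_mult: "Linf q \<Longrightarrow> sq_int f \<Longrightarrow> sq_int (\<lambda>x. q x * f x)"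
  by (rule sq_int_bounded_mult[OF Linf_measurable Linf_AE_bound])

lemma sq_int_Linf: "Linf q \<Longrightarrow> sq_int q"
  using sq_int_Linf_mult[OF _ sq_int_const[of 1]] by simp

lemma L2_norm_Linf_mult:
  assumes "Linf q" "sq_int f"
  shows "L2_norm (\<lambda>x. q x * f x) \<le> Linf_norm q * L2_norm f"
proof (rule power2_le_imp_le)
  have "(\<integral>x. (q x * f x)\<^sup>2 \<partial>unit_interval) \<le> (\<integral>x. (Linf_norm q)\<^sup>2 * (f x)\<^sup>2 \<partial>unit_interval)"
  proof (rule integral_mono_AE)
    show "AE x in unit_interval. (q x * f x)\<^sup>2 \<le> (Linf_norm q)\<^sup>2 * (f x)\<^sup>2"
      using Linf_AE_bound[OF assms(1)]
      by (rule AE_mp) (auto intro!: AE_I2 mult_right_mono abs_le_square_iff[THEN iffD1]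
        simp: power_mult_distrib Linf_norm_nonneg assms)
  qed (use assms sq_int_Linf_mult[OF assms] in \<open>auto simp: sq_int_iff\<close>)
  then show "(L2_norm (\<lambda>x. q x * f x))\<^sup>2 \<le> (Linf_norm q * L2_norm f)\<^sup>2"
    by (simp add: L2_norm_square power_mult_distrib)
qed (simp add: L2_norm_nonneg Linf_norm_nonneg assms)

section \<open>Integral identities for eigenfunctions and for the potential\<close>

lemma dirichlet_eigenfun_derivative:
  assumes "dirichlet_eigenfun q l f" "Linf q"
  shows "\<exists>df. (\<forall>x\<in>{0..1}. (f has_real_derivative df x) (at x within {0..1}))
     \<and> (\<forall>x\<in>{0..1}. df x = df 0 + primitive (\<lambda>s. (q s - l) * f s) x)
     \<and> continuous_on {0..1} df"
proof -
  obtain df where df: "\<And>x. x \<in> {0..1} \<Longrightarrow> (f has_real_derivative df x) (at x within {0..1})"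
    "\<And>x. x \<in> {0..1} \<Longrightarrow> df x = df 0 + primitive (\<lambda>s. (q s - l) * f s) x"
    using assms unfolding dirichlet_eigenfun_def primitive_def by blast
  have "continuous_on {0..1} f"
    using df(1) by (rule DERIV_continuous_on)
  then have "sq_int f"
    by (rule continuous_sq_int)
  then have "sq_int (\<lambda>s. (q s - l) * f s)"
    using assms by (simp add: left_diff_distrib sq_int_diff sq_int_cmult sq_int_Linf_mult)
  then have "continuous_on {0..1} (\<lambda>x. df 0 + primitive (\<lambda>s. (q s - l) * f s) x)"
    by (intro continuous_on_add continuous_on_const continuous_primitive)
  then have "continuous_on {0..1} df"
    by (rule continuous_on_eq) (metis df(2))
  then show ?thesis
    by (intro exI[of _ df] conjI ballI df)
qed

text \<open>Pair f'' = (q - l) f with \<open>h\<close> and integrate by parts. All boundary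
  contributions carry the factor \<open>primitive dh 1\<close> = \<open>h 1\<close> = 0; the
  vanishing of \<open>h\<close> at 0 is built into its being a primitive.\<close>

lemma eigenfun_weak_form:
  assumes int: "Linf q" "sq_int f" "sq_int dh"
    and df: "\<And>x. x \<in> {0..1} \<Longrightarrow> df x = df 0 + primitive (\<lambda>s. (q s - l) * f s) x"
    and h: "\<And>x. x \<in> {0..1} \<Longrightarrow> h x = primitive dh x" "h 1 = 0"
  shows "L2_inner df dh = l * L2_inner f h - L2_inner (\<lambda>x. q x * f x) h"
proof -
  define g where "g = (\<lambda>s. (q s - l) * f s)"
  have g_eq: "g = (\<lambda>s. q s * f s - l * f s)"
    by (simp add: g_def fun_eq_iff left_diff_distrib)
  have qf: "sq_int (\<lambda>s. q s * f s)" and g: "sq_int g"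
    unfolding g_eq by (intro sq_int_diff sq_int_cmult sq_int_Linf_mult int)+
  have h_int: "sq_int (primitive dh)"
    using int by (simp add: sq_int_primitive)
  have "L2_inner df dh = L2_inner (\<lambda>x. df 0 * 1 + primitive g x) dh"
    unfolding g_def mult_1_right by (intro L2_inner_cong refl df)
  also have "\<dots> = df 0 * L2_inner (\<lambda>x. 1) dh + L2_inner (primitive g) dh"
    using int g by (subst L2_inner_add_left) (auto simp: sq_int_const sq_int_primitive
      L2_inner_cmult_left[of "df 0" "\<lambda>x. 1", simplified] intro: sq_int_cmult)
  also have "L2_inner (\<lambda>x. 1) dh = primitive dh 1"
    by (simp add: L2_inner_eq primitive_1)
  also have "primitive dh 1 = 0"
    using h by simp
  also have "L2_inner (primitive g) dh = - L2_inner g (primitive dh)"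
    using integration_by_parts_primitive[OF g \<open>sq_int dh\<close>] \<open>primitive dh 1 = 0\<close>
    by (simp add: L2_inner_commute[of dh])
  also have "L2_inner g (primitive dh) = L2_inner (\<lambda>s. q s * f s) (primitive dh) - l * L2_inner f (primitive dh)"
    unfolding g_eq using int qf h_int
    by (simp add: L2_inner_diff_left sq_int_cmult L2_inner_cmult_left)
  also have "L2_inner (\<lambda>s. q s * f s) (primitive dh) = L2_inner (\<lambda>s. q s * f s) h"
    using h by (intro L2_inner_cong) auto
  also have "L2_inner f (primitive dh) = L2_inner f h"
    using h by (intro L2_inner_cong) auto
  finally show ?thesis by simp
qed

text \<open>The square of \<open>f\<close> is the primitive of 2 f f' and vanishes at both ends, so
  the derivative can be moved from nu onto f^2.\<close>

lemma potential_integration_by_parts: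
  assumes q: "Linf q" and nu: "Linf nu"
    and nu_eq: "AE x in lborel. x \<in> {0..1} \<longrightarrow> nu x = c + (LINT s:{0..x}|lborel. q s)"
    and f: "\<And>x. x \<in> {0..1} \<Longrightarrow> (f has_real_derivative df x) (at x within {0..1})"
      "continuous_on {0..1} df" "f 0 = 0" "f 1 = 0"
  shows "L2_inner (\<lambda>x. q x * f x) f = - 2 * L2_inner (\<lambda>x. nu x * f x) df"
proof -
  define g where "g x = 2 * (f x * df x)" for x
  have f_cont: "continuous_on {0..1} f"
    using f(1) by (rule DERIV_continuous_on)
  have g_cont: "continuous_on {0..1} g"
    unfolding g_def by (intro continuous_intros f_cont f)
  have g_int: "sq_int g"
    by (rule continuous_sq_int[OF g_cont])
  have prim: "primitive g x = (f x)\<^sup>2" if "x \<in> {0..1}" for x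
  proof -
    have "((\<lambda>x. (f x)\<^sup>2) has_real_derivative g x) (at x within {0..1})" if "x \<in> {0..1}" for x
      using f(1)[OF that] unfolding g_def by (auto intro!: derivative_eq_intros)
    from primitive_derivative[OF this g_cont that] show ?thesis
      using f by simp
  qed
  have nu_eq': "AE x in unit_interval. nu x = c + primitive q x"
    using nu_eq by (simp add: AE_unit_interval primitive_def)
  have "L2_inner (\<lambda>x. q x * f x) f = L2_inner q (primitive g)"
    unfolding L2_inner_eq by (intro Bochner_Integration.integral_cong)
      (auto simp: prim space_restrict_space power2_eq_square)
  also have "\<dots> = - L2_inner (primitive q) g"
    using integration_by_parts_primitive[OF sq_int_Linf[OF q] g_int] prim[of 1] f
    by (simp add: L2_inner_commute[of g])
  \<comment> \<open>The integration constant of nu may be inserted, since \<open>g\<close> has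
    integral f(1)^2 = 0.\<close>
  also have "L2_inner (primitive q) g = c * L2_inner (\<lambda>x. 1) g + L2_inner (primitive q) g"
    using prim[of 1] f by (simp add: L2_inner_eq primitive_1)
  also have "\<dots> = L2_inner (\<lambda>x. c * 1 + primitive q x) g"
    by (subst L2_inner_add_left) (auto simp: g_int sq_int_const sq_int_primitive sq_int_Linf q
      L2_inner_cmult_left[of c "\<lambda>x. 1", simplified])
  also have "\<dots> = L2_inner nu g"
    unfolding L2_inner_eq
  proof (rule integral_cong_AE)
    show "AE x in unit_interval. (c * 1 + primitive q x) * g x = nu x * g x"
      using nu_eq' by (rule AE_mp) (auto intro!: AE_I2)
    show "(\<lambda>x. nu x * g x) \<in> borel_measurable unit_interval"
      using Linf_measurable[OF nu] sq_int_measurable[OF g_int] by measurable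
    show "(\<lambda>x. (c * 1 + primitive q x) * g x) \<in> borel_measurable unit_interval"
      using sq_int_measurable[OF sq_int_primitive[OF sq_int_Linf[OF q]]] sq_int_measurable[OF g_int] by measurable
  qed
  also have "\<dots> = 2 * L2_inner (\<lambda>x. nu x * f x) df"
    by (simp add: L2_inner_eq g_def mult.assoc mult.left_commute[of _ 2])
  finally show ?thesis by simp
qed

section \<open>Finite eigenfunction expansions\<close>

lemma L2_inner_tendsto:
  assumes "\<And>n. sq_int (f n)" "sq_int g" "sq_int h"
    and "(\<lambda>n. L2_norm (\<lambda>x. f n x - g x)) \<longlonglongrightarrow> 0"
  shows "(\<lambda>n. L2_inner (f n) h) \<longlonglongrightarrow> L2_inner g h"
proof (rule Lim_transform_bound[OF _ tendsto_mult_left_zero, THEN Lim_null[THEN iffD2]])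
  show "(\<lambda>n. L2_norm (\<lambda>x. f n x - g x)) \<longlonglongrightarrow> 0" by fact
  show "\<forall>\<^sub>F n in sequentially. norm (L2_inner (f n) h - L2_inner g h) \<le> norm (L2_norm (\<lambda>x. f n x - g x) * L2_norm h)"
    using assms L2_Cauchy_Schwarz[OF sq_int_diff, of "f _" g h]
    by (simp add: L2_inner_diff_left[symmetric] L2_norm_nonneg abs_mult)
qed

lemma L2_norm_tendsto:
  assumes "\<And>n. sq_int (f n)" "sq_int g" "(\<lambda>n. L2_norm (\<lambda>x. f n x - g x)) \<longlonglongrightarrow> 0"
  shows "(\<lambda>n. L2_norm (f n)) \<longlonglongrightarrow> L2_norm g"
proof (rule Lim_null[THEN iffD2], rule Lim_null_comparison[OF _ assms(3)])
  show "\<forall>\<^sub>F n in sequentially. norm (L2_norm (f n) - L2_norm g) \<le> L2_norm (\<lambda>x. f n x - g x)"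
    using L2_norm_triangle_diff[OF assms(1,2)] by simp
qed

text \<open>Only blocks of the series have to be controlled. This serves orthogonal series, with the
  squared coefficients as \<open>c\<close>, as well as the derivatives \<open>dphi\<close>, which
  are not orthogonal.\<close>

lemma L2_series_converges:
  assumes int: "\<And>i. sq_int (f i)" and c: "summable c"
    and bound: "\<And>m n. m \<le> n \<Longrightarrow> (L2_norm (\<lambda>x. \<Sum>i=m..<n. f i x))\<^sup>2 \<le> (\<Sum>i=m..<n. c i)"
  obtains g where "sq_int g" "(\<lambda>N. L2_norm (\<lambda>x. (\<Sum>i<N. f i x) - g x)) \<longlonglongrightarrow> 0"
proof (rule L2_complete)
  show "sq_int (\<lambda>x. \<Sum>i<N. f i x)" for N
    by (intro sq_int_sum int)
  fix e :: real assume "e > 0"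
  then obtain N where N: "\<And>m n. m \<ge> N \<Longrightarrow> \<bar>\<Sum>i=m..<n. c i\<bar> < e"
    using c unfolding summable_Cauchy real_norm_def by meson
  have le: "(L2_norm (\<lambda>x. (\<Sum>i<n. f i x) - (\<Sum>i<m. f i x)))\<^sup>2 < e" if "m \<ge> N" "m \<le> n" for m n
  proof -
    have "(\<lambda>x. (\<Sum>i<n. f i x) - (\<Sum>i<m. f i x)) = (\<lambda>x. \<Sum>i=m..<n. f i x)"
      using that by (simp add: fun_eq_iff sum_diff_nat_ivl flip: atLeast0LessThan)
    then show ?thesis
      using bound[OF that(2)] N[OF that(1), of n] by simp
  qed
  have "(L2_norm (\<lambda>x. (\<Sum>i<m. f i x) - (\<Sum>i<n. f i x)))\<^sup>2 < e" if "m \<ge> N" "n \<ge> N" for m n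
  proof (cases "n \<le> m")
    case False
    then show ?thesis
      using le[of m n] that L2_norm_cmult[of "-1" "\<lambda>x. (\<Sum>i<m. f i x) - (\<Sum>i<n. f i x)"] by simp
  qed (use le that in auto)
  then show "\<exists>N. \<forall>m\<ge>N. \<forall>n\<ge>N. (L2_norm (\<lambda>x. (\<Sum>i<m. f i x) - (\<Sum>i<n. f i x)))\<^sup>2 < e"
    by blast
qed (rule that)

text \<open>Positivity is all that is assumed about the size of the eigenvalues; a uniform lower
  bound is derived in \<open>eigenvalues_bounded_below\<close>.\<close>

locale eigenbasis =
  fixes q :: "real \<Rightarrow> real" and lam :: "nat \<Rightarrow> real" and phi :: "nat \<Rightarrow> real \<Rightarrow> real"
  assumes Linf_q: "Linf q" and eigen_ONB: "eigen_ONB q lam phi" and lam_pos: "\<And>n. lam n > 0"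
begin

lemma sq_int_phi: "sq_int (phi n)"
  using eigen_ONB by (simp add: eigen_ONB_def)

lemma orthonormal: "L2_inner (phi m) (phi n) = (if m = n then 1 else 0)"
  using eigen_ONB by (simp add: eigen_ONB_def)

lemma coeff_phi: "coeff phi (phi m) n = (if m = n then 1 else 0)"
  by (simp add: coeff_def orthonormal)

lemma coeff_add: "sq_int f \<Longrightarrow> sq_int g \<Longrightarrow> coeff phi (\<lambda>x. f x + g x) n = coeff phi f n + coeff phi g n"
  by (simp add: coeff_def L2_inner_add_left sq_int_phi)

lemma coeff_cmult: "coeff phi (\<lambda>x. c * f x) n = c * coeff phi f n"
  by (simp add: coeff_def L2_inner_cmult_left)

lemma parseval: "sq_int f \<Longrightarrow> (\<lambda>n. (coeff phi f n)\<^sup>2) sums (L2_norm f)\<^sup>2"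
  using eigen_ONB by (simp add: eigen_ONB_def coeff_def)

text \<open>Polarisation of the Parseval identity.\<close>

lemma parseval_inner:
  assumes "sq_int f" "sq_int g"
  shows "(\<lambda>n. coeff phi f n * coeff phi g n) sums L2_inner f g"
proof -
  have "(\<lambda>n. ((coeff phi (\<lambda>x. f x + g x) n)\<^sup>2 - (coeff phi f n)\<^sup>2 - (coeff phi g n)\<^sup>2) / 2) sums
    (((L2_norm (\<lambda>x. f x + g x))\<^sup>2 - (L2_norm f)\<^sup>2 - (L2_norm g)\<^sup>2) / 2)"
    by (intro sums_divide sums_diff parseval sq_int_add assms)
  then show ?thesis
    by (simp add: coeff_add assms L2_norm_square_add power2_sum)
qed

text \<open>General index sets are allowed because three kinds occur: initial segments, blocks
  \<open>{m..<n}\<close> for the Cauchy criterion, and sets of small eigenvalues.\<close>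

definition comb :: "nat set \<Rightarrow> (nat \<Rightarrow> real) \<Rightarrow> real \<Rightarrow> real" where
  "comb S a x = (\<Sum>n\<in>S. a n * phi n x)"

lemma sq_int_comb: "sq_int (comb S a)"
  unfolding comb_def[abs_def] by (intro sq_int_sum sq_int_cmult sq_int_phi)

lemma L2_inner_comb: "sq_int h \<Longrightarrow> L2_inner (comb S a) h = (\<Sum>n\<in>S. a n * L2_inner (phi n) h)"
  unfolding comb_def[abs_def]
  by (simp add: L2_inner_sum_left sq_int_cmult sq_int_phi L2_inner_cmult_left)

lemma coeff_comb: "finite S \<Longrightarrow> coeff phi (comb S a) n = (if n \<in> S then a n else 0)"
  by (simp add: coeff_def L2_inner_comb sq_int_phi orthonormal if_distrib sum.delta cong: if_cong)

lemma L2_norm_comb: "finite S \<Longrightarrow> (L2_norm (comb S a))\<^sup>2 = (\<Sum>n\<in>S. (a n)\<^sup>2)"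
  unfolding L2_norm_inner
  by (simp add: L2_inner_comb sq_int_comb L2_inner_commute[of "phi _"]
      coeff_comb[unfolded coeff_def] power2_eq_square)

text \<open>Serves to recognise an L^2 limit found by other means, such as a primitive, as the
  function with coefficients \<open>a\<close>.\<close>

lemma coeff_comb_limit:
  assumes "sq_int w" "(\<lambda>N. L2_norm (\<lambda>x. comb {..<N} a x - w x)) \<longlonglongrightarrow> 0"
  shows "coeff phi w n = a n"
proof (rule LIMSEQ_unique)
  show "(\<lambda>N. coeff phi (comb {..<N} a) n) \<longlonglongrightarrow> coeff phi w n"
    unfolding coeff_def using assms by (intro L2_inner_tendsto sq_int_comb sq_int_phi)
  show "(\<lambda>N. coeff phi (comb {..<N} a) n) \<longlonglongrightarrow> a n"
    by (rule tendsto_eventually, rule eventually_sequentiallyI[of "Suc n"]) (simp add: coeff_comb)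
qed

lemma comb_converges:
  assumes "summable (\<lambda>n. (a n)\<^sup>2)"
  obtains g where "sq_int g" "\<And>n. coeff phi g n = a n"
    "(\<lambda>N. L2_norm (\<lambda>x. comb {..<N} a x - g x)) \<longlonglongrightarrow> 0"
proof -
  obtain g where g: "sq_int g" "(\<lambda>N. L2_norm (\<lambda>x. (\<Sum>n<N. a n * phi n x) - g x)) \<longlonglongrightarrow> 0"
  proof (rule L2_series_converges)
    show "(L2_norm (\<lambda>x. \<Sum>i=m..<n. a i * phi i x))\<^sup>2 \<le> (\<Sum>i=m..<n. (a i)\<^sup>2)" for m n
      using L2_norm_comb[of "{m..<n}" a] by (simp add: comb_def[abs_def])
  qed (use assms in \<open>auto intro: sq_int_cmult sq_int_phi\<close>)
  then have lim: "(\<lambda>N. L2_norm (\<lambda>x. comb {..<N} a x - g x)) \<longlonglongrightarrow> 0"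
    by (simp add: comb_def)
  with coeff_comb_limit[OF g(1) lim] g(1) that show ?thesis by blast
qed

text \<open>\<open>dirichlet_eigenfun\<close> asserts only that a derivative exists; the choice
  fixes one that carries the pointwise, the integral and the continuity property together.\<close>

definition dphi :: "nat \<Rightarrow> real \<Rightarrow> real" where
  "dphi n = (SOME d. (\<forall>x\<in>{0..1}. (phi n has_real_derivative d x) (at x within {0..1}))
     \<and> (\<forall>x\<in>{0..1}. d x = d 0 + primitive (\<lambda>s. (q s - lam n) * phi n s) x)
     \<and> continuous_on {0..1} d)"

lemma dphi:
  shows phi_derivative: "x \<in> {0..1} \<Longrightarrow> (phi n has_real_derivative dphi n x) (at x within {0..1})"
    and dphi_primitive: "x \<in> {0..1} \<Longrightarrow> dphi n x = dphi n 0 + primitive (\<lambda>s. (q s - lam n) * phi n s) x"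
    and continuous_dphi: "continuous_on {0..1} (dphi n)"
    and phi_0: "phi n 0 = 0" and phi_1: "phi n 1 = 0"
proof -
  have eig: "dirichlet_eigenfun q (lam n) (phi n)"
    using eigen_ONB by (simp add: eigen_ONB_def)
  then show "phi n 0 = 0" "phi n 1 = 0"
    by (simp_all add: dirichlet_eigenfun_def)
  note * = someI_ex[OF dirichlet_eigenfun_derivative[OF eig Linf_q], folded dphi_def]
  from * show "continuous_on {0..1} (dphi n)"
    by (elim conjE)
  show "(phi n has_real_derivative dphi n x) (at x within {0..1})" if "x \<in> {0..1}"
    using bspec[OF conjunct1[OF *] that] .
  show "dphi n x = dphi n 0 + primitive (\<lambda>s. (q s - lam n) * phi n s) x" if "x \<in> {0..1}"
    using bspec[OF conjunct1[OF conjunct2[OF *]] that] .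
qed

lemma sq_int_dphi: "sq_int (dphi n)"
  by (rule continuous_sq_int[OF continuous_dphi])

definition dcomb :: "nat set \<Rightarrow> (nat \<Rightarrow> real) \<Rightarrow> real \<Rightarrow> real" where
  "dcomb S a x = (\<Sum>n\<in>S. a n * dphi n x)"

lemma sq_int_dcomb: "sq_int (dcomb S a)"
  unfolding dcomb_def[abs_def] by (intro sq_int_sum sq_int_cmult sq_int_dphi)

lemma comb_derivative:
  "x \<in> {0..1} \<Longrightarrow> (comb S a has_real_derivative dcomb S a x) (at x within {0..1})"
  unfolding comb_def[abs_def] dcomb_def by (intro DERIV_sum DERIV_cmult phi_derivative)

lemma continuous_dcomb: "continuous_on {0..1} (dcomb S a)"
  unfolding dcomb_def[abs_def] by (intro continuous_intros continuous_dphi)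

lemma comb_0: "comb S a 0 = 0" and comb_1: "comb S a 1 = 0"
  by (simp_all add: comb_def phi_0 phi_1)

lemma comb_primitive: "x \<in> {0..1} \<Longrightarrow> comb S a x = primitive (dcomb S a) x"
  using primitive_derivative[OF comb_derivative continuous_dcomb] by (simp add: comb_0)

section \<open>Energy estimates for finite combinations and the lower bound of the spectrum\<close>

lemma energy_identity:
  assumes "finite S"
  shows "(L2_norm (dcomb S a))\<^sup>2
    = (\<Sum>n\<in>S. lam n * (a n)\<^sup>2) - L2_inner (\<lambda>x. q x * comb S a x) (comb S a)"
proof -
  have "(L2_norm (dcomb S a))\<^sup>2 = (\<Sum>n\<in>S. a n * L2_inner (dphi n) (dcomb S a))"
    unfolding L2_norm_inner
    by (subst dcomb_def[abs_def]) (simp add: L2_inner_sum_left sq_int_cmult sq_int_dphi sq_int_dcomb L2_inner_cmult_left)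
  also have "\<dots> = (\<Sum>n\<in>S. lam n * (a n)\<^sup>2 - a n * L2_inner (\<lambda>x. q x * phi n x) (comb S a))"
  proof (rule sum.cong[OF refl])
    fix n assume "n \<in> S"
    have "L2_inner (phi n) (comb S a) = a n"
      using coeff_comb[OF assms, of a n] \<open>n \<in> S\<close> by (simp add: coeff_def L2_inner_commute)
    then show "a n * L2_inner (dphi n) (dcomb S a)
      = lam n * (a n)\<^sup>2 - a n * L2_inner (\<lambda>x. q x * phi n x) (comb S a)"
      \<comment> \<open>The combination itself is the test function: it vanishes at both ends, and
        its inner product with \<open>phi n\<close> is \<open>a n\<close>.\<close>
      using eigenfun_weak_form[OF Linf_q sq_int_phi sq_int_dcomb dphi_primitive comb_primitive comb_1, of n S a]
      by (simp add: power2_eq_square right_diff_distrib)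
  qed
  also have "\<dots> = (\<Sum>n\<in>S. lam n * (a n)\<^sup>2) - L2_inner (\<lambda>x. \<Sum>n\<in>S. a n * (q x * phi n x)) (comb S a)"
    by (subst L2_inner_sum_left)
      (auto intro!: sq_int_cmult sq_int_Linf_mult sq_int_comb sq_int_phi Linf_q simp: sum_subtractf L2_inner_cmult_left)
  also have "(\<lambda>x. \<Sum>n\<in>S. a n * (q x * phi n x)) = (\<lambda>x. q x * comb S a x)"
    by (simp add: comb_def sum_distrib_left mult.left_commute)
  finally show ?thesis .
qed

text \<open>The bound is a sum over \<open>S\<close> of terms depending on one index each, the form
  that \<open>L2_series_converges\<close> asks for.\<close>

lemma gradient_bound:
  assumes "Linf nu" "AE x in lborel. x \<in> {0..1} \<longrightarrow> nu x = c + (LINT s:{0..x}|lborel. q s)"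
    and "finite S"
  shows "(L2_norm (dcomb S a))\<^sup>2 \<le> (\<Sum>n\<in>S. 2 * (lam n * (a n)\<^sup>2) + 4 * (Linf_norm nu)\<^sup>2 * (a n)\<^sup>2)"
proof -
  define A where "A = L2_norm (dcomb S a)"
  define B where "B = Linf_norm nu * L2_norm (comb S a)"
  have "\<bar>L2_inner (\<lambda>x. nu x * comb S a x) (dcomb S a)\<bar> \<le> L2_norm (\<lambda>x. nu x * comb S a x) * A"
    unfolding A_def by (intro L2_Cauchy_Schwarz sq_int_Linf_mult assms sq_int_comb sq_int_dcomb)
  also have "\<dots> \<le> B * A"
    unfolding A_def B_def by (intro mult_right_mono L2_norm_Linf_mult assms sq_int_comb L2_norm_nonneg)
  finally have "\<bar>L2_inner (\<lambda>x. nu x * comb S a x) (dcomb S a)\<bar> \<le> B * A" .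
  then have "A\<^sup>2 \<le> (\<Sum>n\<in>S. lam n * (a n)\<^sup>2) + 2 * (B * A)"
    using energy_identity[OF assms(3), of a] potential_integration_by_parts[OF Linf_q assms(1,2)
      comb_derivative continuous_dcomb comb_0 comb_1, of S a]
    by (simp add: A_def)
  \<comment> \<open>Young's inequality from (2 B - A)^2 >= 0; absorbing half of A^2 produces the
    constants 2 and 4.\<close>
  moreover have "2 * (B * A) \<le> 2 * B\<^sup>2 + A\<^sup>2 / 2"
    using zero_le_power2[of "2 * B - A"] by (simp add: power2_eq_square algebra_simps)
  ultimately have "A\<^sup>2 \<le> 2 * (\<Sum>n\<in>S. lam n * (a n)\<^sup>2) + 4 * B\<^sup>2"
    by simp
  also have "B\<^sup>2 = (Linf_norm nu)\<^sup>2 * (\<Sum>n\<in>S. (a n)\<^sup>2)"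
    by (simp add: B_def power_mult_distrib L2_norm_comb assms)
  finally show ?thesis
    by (simp add: A_def sum.distrib sum_distrib_left mult.assoc)
qed

text \<open>The kernel \<open>K x = (\<Sum>n\<in>S. phi n x ^ 2)\<close> is itself a combination \<open>f x\<close> with coefficients
  \<open>phi n x\<close>, so \<open>(K x)\<^sup>2 \<le> \<parallel>f'\<parallel>\<^sup>2 \<le> (M + \<parallel>q\<parallel>) * K x\<close>; integrating \<open>K\<close> counts \<open>S\<close>.\<close>

lemma card_eigenvalues_le:
  assumes "finite S" "\<And>n. n \<in> S \<Longrightarrow> lam n \<le> M" "M \<ge> 0"
  shows "real (card S) \<le> M + Linf_norm q"
proof -
  define B where "B = M + Linf_norm q"
  have "B \<ge> 0"
    using Linf_norm_nonneg[OF Linf_q] assms by (simp add: B_def)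
  \<comment> \<open>The potential term is bounded directly by the supremum norm of \<open>q\<close>;
    no antiderivative nu is available in this locale.\<close>
  have energy: "(L2_norm (dcomb S a))\<^sup>2 \<le> B * (\<Sum>n\<in>S. (a n)\<^sup>2)" for a
  proof -
    have "\<bar>L2_inner (\<lambda>x. q x * comb S a x) (comb S a)\<bar> \<le> L2_norm (\<lambda>x. q x * comb S a x) * L2_norm (comb S a)"
      by (intro L2_Cauchy_Schwarz sq_int_Linf_mult Linf_q sq_int_comb)
    also have "\<dots> \<le> Linf_norm q * L2_norm (comb S a) * L2_norm (comb S a)"
      by (intro mult_right_mono L2_norm_Linf_mult Linf_q sq_int_comb L2_norm_nonneg)
    also have "\<dots> = Linf_norm q * (\<Sum>n\<in>S. (a n)\<^sup>2)"
      by (simp add: mult.assoc flip: power2_eq_square) (simp add: L2_norm_comb assms)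
    finally have "\<bar>L2_inner (\<lambda>x. q x * comb S a x) (comb S a)\<bar> \<le> \<dots>" .
    moreover have "(\<Sum>n\<in>S. lam n * (a n)\<^sup>2) \<le> M * (\<Sum>n\<in>S. (a n)\<^sup>2)"
      unfolding sum_distrib_left using assms by (intro sum_mono mult_right_mono) auto
    ultimately show ?thesis
      using energy_identity[OF assms(1), of a] by (simp add: B_def distrib_right)
  qed
  have K: "(\<Sum>n\<in>S. (phi n x)\<^sup>2) \<le> B" if "x \<in> {0..1}" for x
  proof (rule ccontr)
    define K where "K = (\<Sum>n\<in>S. (phi n x)\<^sup>2)"
    assume "\<not> (\<Sum>n\<in>S. (phi n x)\<^sup>2) \<le> B"
    then have "K > B" by (simp add: K_def)
    have "\<bar>K\<bar> = \<bar>primitive (dcomb S (\<lambda>n. phi n x)) x\<bar>"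
      using comb_primitive[OF that, of S "\<lambda>n. phi n x"] by (simp add: K_def comb_def power2_eq_square)
    also have "\<dots> \<le> L2_norm (dcomb S (\<lambda>n. phi n x))"
      by (intro primitive_le_L2_norm sq_int_dcomb that)
    finally have "\<bar>K\<bar>\<^sup>2 \<le> (L2_norm (dcomb S (\<lambda>n. phi n x)))\<^sup>2"
      by (intro power_mono) auto
    also have "\<dots> \<le> B * K"
      using energy by (simp add: K_def)
    finally have "K * K \<le> B * K"
      by (simp add: power2_eq_square)
    with \<open>K > B\<close> \<open>B \<ge> 0\<close> show False
      by simp
  qed
  have "real (card S) = (\<Sum>n\<in>S. \<integral>x. (phi n x)\<^sup>2 \<partial>unit_interval)"
    by (simp add: L2_norm_square[symmetric] L2_norm_inner orthonormal)
  also have "\<dots> = (\<integral>x. (\<Sum>n\<in>S. (phi n x)\<^sup>2) \<partial>unit_interval)"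
    using sq_int_phi by (subst Bochner_Integration.integral_sum) (auto simp: sq_int_iff)
  also have "\<dots> \<le> (\<integral>x. B \<partial>unit_interval)"
    using sq_int_phi K by (intro integral_mono) (auto simp: sq_int_iff space_restrict_space)
  also have "\<dots> = B"
    by (simp add: measure_restrict_space space_restrict_space)
  finally show ?thesis by (simp add: B_def)
qed

text \<open>By the count only finitely many eigenvalues are at most 1, and a minimum of finitely
  many positive numbers is positive. The threshold 1 is arbitrary.\<close>

lemma eigenvalues_bounded_below:
  obtains c where "c > 0" "\<And>n. c \<le> lam n"
proof -
  define S where "S = {n. lam n \<le> 1}"
  have "finite S"
  proof (rule ccontr)
    obtain m :: nat where m: "1 + Linf_norm q < real m"
      using reals_Archimedean2 by blast
    assume "infinite S"
    then obtain S' where "finite S'" "card S' = m" "S' \<subseteq> S"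
      by (metis infinite_arbitrarily_large)
    then show False
      using card_eigenvalues_le[of S' 1] m by (auto simp: S_def)
  qed
  \<comment> \<open>Inserting 1 covers the eigenvalues above the threshold and keeps the set
    nonempty.\<close>
  define c where "c = Min (insert 1 (lam ` S))"
  have "c > 0"
    using \<open>finite S\<close> lam_pos by (auto simp: c_def)
  moreover have "c \<le> lam n" for n
  proof (cases "n \<in> S")
    case True
    then show ?thesis using \<open>finite S\<close> by (auto simp: c_def)
  next
    case False
    have "c \<le> 1" using \<open>finite S\<close> by (auto simp: c_def)
    then show ?thesis using False by (simp add: S_def)
  qed
  ultimately show ?thesis using that by blast
qed

end

section \<open>Sequence representation of the Sobolev spaces\<close>

context eigenbasis
begin

lemma lam_powr_mono:
  assumes "r \<le> s"
  obtains K where "K > 0" "\<And>n. lam n powr r \<le> K * lam n powr s"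
proof -
  obtain c where c: "c > 0" "\<And>n. c \<le> lam n"
    by (rule eigenvalues_bounded_below) blast
  \<comment> \<open>The exponent r - s is at most 0, so the power is largest at the lower bound
    \<open>c\<close> of the spectrum.\<close>
  have "lam n powr r \<le> c powr (r - s) * lam n powr s" for n
  proof -
    have "lam n powr r = lam n powr (r - s) * lam n powr s"
      using lam_pos[of n] by (simp flip: powr_add)
    also have "\<dots> \<le> c powr (r - s) * lam n powr s"
      using c assms lam_pos[of n] by (intro mult_right_mono powr_mono2') auto
    finally show ?thesis .
  qed
  with c that[of "c powr (r - s)"] show ?thesis
    by auto
qed

lemma summable_weight_mono:
  assumes "summable (\<lambda>n. lam n powr s * (a n)\<^sup>2)" "r \<le> s"
  shows "summable (\<lambda>n. lam n powr r * (a n)\<^sup>2)"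
proof -
  obtain K where K: "K > 0" "\<And>n. lam n powr r \<le> K * lam n powr s"
    using lam_powr_mono[OF assms(2)] by blast
  show ?thesis
  proof (rule summable_comparison_test')
    show "summable (\<lambda>n. K * (lam n powr s * (a n)\<^sup>2))"
      using assms by (intro summable_mult)
    show "norm (lam n powr r * (a n)\<^sup>2) \<le> K * (lam n powr s * (a n)\<^sup>2)" for n
      using mult_right_mono[OF K(2), of "(a n)\<^sup>2" n] by (simp add: mult.assoc)
  qed
qed

lemma lam_power_eq_powr: "lam n ^ m = lam n powr real m"
  using lam_pos[of n] by (simp add: powr_realpow)

lemma lam_powr_square: "(lam n powr r)\<^sup>2 = lam n powr (2 * r)"
  by (simp add: power2_eq_square flip: powr_add)

text \<open>Even integer exponents are arbitrarily large, and the nesting of the weights passes down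
  from them to every real exponent, negative ones included.\<close>

lemma test_fun_iff:
  "test_fun lam phi psi \<longleftrightarrow> sq_int psi \<and> (\<forall>s. summable (\<lambda>n. lam n powr s * (coeff phi psi n)\<^sup>2))"
proof
  assume test: "test_fun lam phi psi"
  have "summable (\<lambda>n. lam n powr s * (coeff phi psi n)\<^sup>2)" for s
  proof -
    obtain m :: nat where "s \<le> real m"
      using real_arch_simple by blast
    then show ?thesis
      using test by (intro summable_weight_mono[of "real (2 * m)" _ s])
        (auto simp: test_fun_def lam_power_eq_powr)
  qed
  with test show "sq_int psi \<and> (\<forall>s. summable (\<lambda>n. lam n powr s * (coeff phi psi n)\<^sup>2))"
    by (simp add: test_fun_def)
qed (auto simp: test_fun_def lam_power_eq_powr)

lemma test_fun_exists:
  assumes "\<And>s. summable (\<lambda>n. lam n powr s * (a n)\<^sup>2)"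
  obtains psi where "test_fun lam phi psi" "\<And>n. coeff phi psi n = a n"
proof -
  have "summable (\<lambda>n. (a n)\<^sup>2)"
    \<comment> \<open>Exponent 0 gives weight 1 because \<open>lam n\<close> is nonzero;
      \<open>0 powr 0\<close> would be 0.\<close>
    using assms[of 0] lam_pos by (simp add: less_imp_neq[symmetric])
  then obtain psi where "sq_int psi" "\<And>n. coeff phi psi n = a n"
    by (rule comb_converges) blast
  with assms that[of psi] show ?thesis
    by (simp add: test_fun_iff)
qed

text \<open>L^s acts on the test functions. Hence every test function occurs as \<open>psi\<close>,
  and also as \<open>chi\<close>, in \<open>Lpow_rep\<close>.\<close>

lemma test_fun_Lpow:
  assumes "test_fun lam phi psi"
  obtains chi where "test_fun lam phi chi" "\<And>n. coeff phi chi n = lam n powr s * coeff phi psi n"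
proof (rule test_fun_exists)
  show "summable (\<lambda>n. lam n powr r * (lam n powr s * coeff phi psi n)\<^sup>2)" for r
  proof -
    have "lam n powr r * (lam n powr s * coeff phi psi n)\<^sup>2 = lam n powr (r + 2 * s) * (coeff phi psi n)\<^sup>2" for n
      by (simp add: power_mult_distrib lam_powr_square powr_add)
    then show ?thesis
      using assms by (simp add: test_fun_iff)
  qed
qed (rule that)

lemma test_fun_lincomb:
  assumes "test_fun lam phi psi1" "test_fun lam phi psi2"
  shows "test_fun lam phi (\<lambda>x. a * psi1 x + b * psi2 x)"
proof -
  have int: "sq_int psi1" "sq_int psi2"
    using assms by (auto simp: test_fun_def)
  have "summable (\<lambda>n. lam n powr s * (a * coeff phi psi1 n + b * coeff phi psi2 n)\<^sup>2)" for s
  proof (rule summable_comparison_test')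
    show "summable (\<lambda>n. 2 * a\<^sup>2 * (lam n powr s * (coeff phi psi1 n)\<^sup>2) + 2 * b\<^sup>2 * (lam n powr s * (coeff phi psi2 n)\<^sup>2))"
      using assms by (intro summable_add summable_mult) (auto simp: test_fun_iff)
    from mult_left_mono[OF square_add_le, of "lam n powr s" "a * coeff phi psi1 n" "b * coeff phi psi2 n" for n]
    show "norm (lam n powr s * (a * coeff phi psi1 n + b * coeff phi psi2 n)\<^sup>2)
      \<le> 2 * a\<^sup>2 * (lam n powr s * (coeff phi psi1 n)\<^sup>2) + 2 * b\<^sup>2 * (lam n powr s * (coeff phi psi2 n)\<^sup>2)" for n
      by (simp add: power_mult_distrib algebra_simps)
  qed
  then show ?thesis
    by (simp add: test_fun_iff int sq_int_add sq_int_cmult coeff_add coeff_cmult)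
qed

text \<open>The multiple with c = \<open>lam n\<close> is the image of \<open>phi n\<close> under L,
  needed to test the wave equation mode by mode.\<close>

lemma test_fun_cmult_phi: "test_fun lam phi (\<lambda>x. c * phi n x)"
proof -
  have "summable (\<lambda>m. lam m powr s * (coeff phi (\<lambda>x. c * phi n x) m)\<^sup>2)" for s
    by (rule summable_finite[of "{n}"]) (auto simp: coeff_cmult coeff_phi)
  then show ?thesis
    by (simp add: test_fun_iff sq_int_cmult sq_int_phi)
qed

lemma test_fun_phi: "test_fun lam phi (phi n)"
  using test_fun_cmult_phi[of 1] by simp

text \<open>F is the distribution given by the sum of a_n phi_n. This is a relation because the
  values of \<open>F\<close> off the test functions are arbitrary.\<close>

definition has_coeffs :: "((real \<Rightarrow> real) \<Rightarrow> real) \<Rightarrow> (nat \<Rightarrow> real) \<Rightarrow> bool" where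
  "has_coeffs F a \<longleftrightarrow> (\<forall>psi. test_fun lam phi psi \<longrightarrow> (\<lambda>n. a n * coeff phi psi n) sums F psi)"

lemma has_coeffs_cmult_phi:
  assumes "has_coeffs F a"
  shows "F (\<lambda>x. c * phi n x) = c * a n"
proof -
  have "(\<lambda>m. a m * coeff phi (\<lambda>x. c * phi n x) m) sums F (\<lambda>x. c * phi n x)"
    using assms test_fun_cmult_phi by (auto simp: has_coeffs_def)
  moreover have "(\<lambda>m. a m * coeff phi (\<lambda>x. c * phi n x) m) sums (\<Sum>m\<in>{n}. a m * coeff phi (\<lambda>x. c * phi n x) m)"
    by (rule sums_finite) (auto simp: coeff_cmult coeff_phi)
  ultimately show ?thesis
    by (auto dest: sums_unique2 simp: coeff_cmult coeff_phi mult.commute)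
qed

lemma has_coeffs_phi: "has_coeffs F a \<Longrightarrow> F (phi n) = a n"
  using has_coeffs_cmult_phi[of F a 1] by simp

lemma has_coeffs_diff:
  "has_coeffs F a \<Longrightarrow> has_coeffs G b \<Longrightarrow> has_coeffs (\<lambda>psi. F psi - G psi) (\<lambda>n. a n - b n)"
  by (auto simp: has_coeffs_def left_diff_distrib intro: sums_diff)

lemma has_coeffs_divide:
  "has_coeffs F a \<Longrightarrow> has_coeffs (\<lambda>psi. F psi / c) (\<lambda>n. a n / c)"
  by (auto simp: has_coeffs_def dest: sums_divide[of _ _ c])

lemma has_coeffs_unique:
  "has_coeffs F a \<Longrightarrow> has_coeffs G a \<Longrightarrow> distr_eq lam phi F G"
  by (auto simp: has_coeffs_def distr_eq_def intro: sums_unique2)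

text \<open>Duality of weighted l^2 spaces: distribute the weights lam^(s/2) and lam^(-s/2) over the
  two factors and use xy <= x^2 + y^2.\<close>

lemma coeff_mult_summable:
  assumes "summable (\<lambda>n. lam n powr s * (a n)\<^sup>2)" "test_fun lam phi psi"
  shows "summable (\<lambda>n. \<bar>a n * coeff phi psi n\<bar>)"
proof (rule summable_comparison_test')
  show "summable (\<lambda>n. lam n powr s * (a n)\<^sup>2 + lam n powr (- s) * (coeff phi psi n)\<^sup>2)"
    using assms by (intro summable_add) (auto simp: test_fun_iff)
  show "norm \<bar>a n * coeff phi psi n\<bar> \<le> lam n powr s * (a n)\<^sup>2 + lam n powr (- s) * (coeff phi psi n)\<^sup>2" for n
  proof -
    define x where "x = lam n powr (s / 2) * \<bar>a n\<bar>"
    define y where "y = lam n powr (- s / 2) * \<bar>coeff phi psi n\<bar>"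
    have "0 < lam n powr (s / 2)" "lam n powr (s / 2) * lam n powr (- s / 2) = 1"
      using lam_pos[of n] by (auto simp flip: powr_add)
    then have "\<bar>a n * coeff phi psi n\<bar> = x * y"
      by (simp add: x_def y_def abs_mult)
    also have "\<dots> \<le> x\<^sup>2 + y\<^sup>2"
      using sum_squares_bound[of x y] zero_le_power2[of x] zero_le_power2[of y] by linarith
    also have "x\<^sup>2 = lam n powr s * (a n)\<^sup>2"
      by (simp add: x_def power_mult_distrib lam_powr_square)
    also have "y\<^sup>2 = lam n powr (- s) * (coeff phi psi n)\<^sup>2"
      by (simp add: y_def power_mult_distrib lam_powr_square)
    finally show ?thesis by simp
  qed
qed

definition series_distr :: "(nat \<Rightarrow> real) \<Rightarrow> (real \<Rightarrow> real) \<Rightarrow> real" where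
  "series_distr a psi = (\<Sum>n. a n * coeff phi psi n)"

lemma has_coeffs_series_distr:
  assumes "summable (\<lambda>n. lam n powr s * (a n)\<^sup>2)"
  shows "has_coeffs (series_distr a) a"
  unfolding has_coeffs_def series_distr_def
  using summable_sums[OF summable_rabs_cancel[OF coeff_mult_summable[OF assms]]] by blast

text \<open>Invert the power: with chi = L^(-s/2) psi one has psi = L^(s/2) chi, so F(psi) = <g,
  chi>. Thus F has coefficients lam^(-s/2) g_n, and its weighted norm is the Parseval sum of
  \<open>g\<close>.\<close>

lemma Lpow_rep_imp:
  assumes "Lpow_rep lam phi (s / 2) F g"
  shows "has_coeffs F (\<lambda>n. F (phi n))" "(\<lambda>n. lam n powr s * (F (phi n))\<^sup>2) sums (L2_norm g)\<^sup>2"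
proof -
  have g: "sq_int g"
    using assms by (simp add: Lpow_rep_def)
  have "has_coeffs F (\<lambda>n. lam n powr (- s / 2) * coeff phi g n)"
    unfolding has_coeffs_def
  proof (intro allI impI)
    fix psi assume psi: "test_fun lam phi psi"
    obtain chi where chi: "test_fun lam phi chi" "\<And>n. coeff phi chi n = lam n powr (- s / 2) * coeff phi psi n"
      using test_fun_Lpow[OF psi, of "- s / 2"] by blast
    have "coeff phi psi n = lam n powr (s / 2) * coeff phi chi n" for n
      using lam_pos[of n] by (simp add: chi powr_minus)
    then have "F psi = L2_inner g chi"
      using assms psi chi(1) by (simp add: Lpow_rep_def)
    moreover have "(\<lambda>n. coeff phi g n * coeff phi chi n) sums L2_inner g chi"
      using g chi by (intro parseval_inner) (auto simp: test_fun_def)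
    ultimately show "(\<lambda>n. lam n powr (- s / 2) * coeff phi g n * coeff phi psi n) sums F psi"
      by (simp add: chi mult.assoc mult.left_commute)
  qed
  moreover from has_coeffs_phi[OF this] have F: "F (phi n) = lam n powr (- s / 2) * coeff phi g n" for n .
  ultimately show "has_coeffs F (\<lambda>n. F (phi n))"
    by simp
  have "lam n powr s * (F (phi n))\<^sup>2 = (coeff phi g n)\<^sup>2" for n
    using lam_pos[of n] by (simp add: F power_mult_distrib lam_powr_square flip: mult.assoc powr_add)
  then show "(\<lambda>n. lam n powr s * (F (phi n))\<^sup>2) sums (L2_norm g)\<^sup>2"
    using parseval[OF g] by simp
qed

lemma Lpow_rep_exists:
  assumes F: "has_coeffs F a" and a: "summable (\<lambda>n. lam n powr s * (a n)\<^sup>2)"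
  obtains g where "Lpow_rep lam phi (s / 2) F g"
proof -
  have "summable (\<lambda>n. (lam n powr (s / 2) * a n)\<^sup>2)"
    using a by (simp add: power_mult_distrib lam_powr_square)
  then obtain g where g: "sq_int g" "\<And>n. coeff phi g n = lam n powr (s / 2) * a n"
    by (rule comb_converges) blast
  have "F chi = L2_inner g psi" if test: "test_fun lam phi psi" "test_fun lam phi chi"
    and chi: "\<And>n. coeff phi chi n = lam n powr (s / 2) * coeff phi psi n" for psi chi
  proof (rule sums_unique2)
    show "(\<lambda>n. a n * coeff phi chi n) sums F chi"
      using F test by (auto simp: has_coeffs_def)
    show "(\<lambda>n. a n * coeff phi chi n) sums L2_inner g psi"
      using parseval_inner[of g psi] g test by (simp add: test_fun_def chi mult_ac)
  qed
  with g(1) have "Lpow_rep lam phi (s / 2) F g"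
    by (simp add: Lpow_rep_def)
  then show ?thesis by (rule that)
qed

lemma L_distr_has_coeffs:
  assumes F: "has_coeffs F a" and a: "summable (\<lambda>n. lam n powr s * (a n)\<^sup>2)"
  shows "L_distr lam phi F"
  unfolding L_distr_def
proof (intro conjI allI impI; (elim conjE)?)
  fix psi1 psi2 c d
  assume test: "test_fun lam phi psi1" "test_fun lam phi psi2"
  have "(\<lambda>n. c * (a n * coeff phi psi1 n) + d * (a n * coeff phi psi2 n)) sums (c * F psi1 + d * F psi2)"
    using F test by (intro sums_add sums_mult) (auto simp: has_coeffs_def)
  moreover have "(\<lambda>n. a n * coeff phi (\<lambda>x. c * psi1 x + d * psi2 x) n) sums F (\<lambda>x. c * psi1 x + d * psi2 x)"
    using F test_fun_lincomb[OF test] by (auto simp: has_coeffs_def)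
  ultimately show "F (\<lambda>x. c * psi1 x + d * psi2 x) = c * F psi1 + d * F psi2"
    using test by (intro sums_unique2) (auto simp: test_fun_def coeff_add coeff_cmult sq_int_cmult algebra_simps)
next
  obtain g where g: "Lpow_rep lam phi (s / 2) F g"
    using Lpow_rep_exists[OF F a] .
  \<comment> \<open>With 2m >= -s, the norm of L^(-s/2) psi is controlled by that of L^m psi, one of
    the norms in \<open>test_seminorm\<close>.\<close>
  obtain m :: nat where "- s \<le> real m"
    using real_arch_simple by blast
  then obtain K where K: "K > 0" "\<And>n. lam n powr (- s) \<le> K * lam n powr (real (2 * m))"
    using lam_powr_mono[of "- s" "real (2 * m)"] by auto
  have "\<bar>F psi\<bar> \<le> L2_norm g * sqrt K * test_seminorm lam phi m psi" if psi: "test_fun lam phi psi" for psi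
  proof -
    obtain chi where chi: "test_fun lam phi chi" "\<And>n. coeff phi chi n = lam n powr (- s / 2) * coeff phi psi n"
      using test_fun_Lpow[OF psi, of "- s / 2"] by blast
    have "coeff phi psi n = lam n powr (s / 2) * coeff phi chi n" for n
      using lam_pos[of n] by (simp add: chi powr_minus)
    then have "F psi = L2_inner g chi"
      using g psi chi(1) by (simp add: Lpow_rep_def)
    then have "\<bar>F psi\<bar> \<le> L2_norm g * L2_norm chi"
      using L2_Cauchy_Schwarz[of g chi] g chi(1) by (simp add: Lpow_rep_def test_fun_def)
    also have "L2_norm chi \<le> sqrt (K * (\<Sum>n. lam n ^ (2 * m) * (coeff phi psi n)\<^sup>2))"
    proof (rule real_le_rsqrt)
      have sums: "(\<lambda>n. lam n powr (- s) * (coeff phi psi n)\<^sup>2) sums (L2_norm chi)\<^sup>2"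
        using parseval[of chi] chi by (simp add: test_fun_def power_mult_distrib lam_powr_square)
      have "(L2_norm chi)\<^sup>2 \<le> (\<Sum>n. K * (lam n ^ (2 * m) * (coeff phi psi n)\<^sup>2))"
        unfolding sums_unique[OF sums]
      proof (rule suminf_le)
        show "lam n powr (- s) * (coeff phi psi n)\<^sup>2 \<le> K * (lam n ^ (2 * m) * (coeff phi psi n)\<^sup>2)" for n
          using mult_right_mono[OF K(2), of "(coeff phi psi n)\<^sup>2" n] by (simp add: lam_power_eq_powr mult.assoc)
      qed (use psi sums in \<open>auto simp: test_fun_def sums_iff intro: summable_mult\<close>)
      also have "\<dots> = K * (\<Sum>n. lam n ^ (2 * m) * (coeff phi psi n)\<^sup>2)"
        using psi by (intro suminf_mult) (simp add: test_fun_def)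
      finally show "(L2_norm chi)\<^sup>2 \<le> K * (\<Sum>n. lam n ^ (2 * m) * (coeff phi psi n)\<^sup>2)" .
    qed
    also have "\<dots> = sqrt K * sqrt (\<Sum>n. lam n ^ (2 * m) * (coeff phi psi n)\<^sup>2)"
      by (rule real_sqrt_mult)
    also have "sqrt (\<Sum>n. lam n ^ (2 * m) * (coeff phi psi n)\<^sup>2) \<le> test_seminorm lam phi m psi"
      unfolding test_seminorm_def by (intro Max_ge) auto
    finally show ?thesis
      using K(1) by (simp add: mult_left_mono L2_norm_nonneg mult.assoc)
  qed
  then show "\<exists>m C. \<forall>psi. test_fun lam phi psi \<longrightarrow> \<bar>F psi\<bar> \<le> C * test_seminorm lam phi m psi"
    by blast
qed

lemma W_L_has_coeffs:
  assumes "W_L lam phi s F"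
  shows "has_coeffs F (\<lambda>n. F (phi n))" "summable (\<lambda>n. lam n powr s * (F (phi n))\<^sup>2)"
  using assms Lpow_rep_imp[of s F] by (auto simp: W_L_def sums_iff)

text \<open>The choice inside \<open>W_norm\<close> is harmless: every representative has this
  weighted sum as its squared norm.\<close>

lemma W_norm_sums:
  assumes "has_coeffs F a" "summable (\<lambda>n. lam n powr s * (a n)\<^sup>2)"
  shows "(\<lambda>n. lam n powr s * (a n)\<^sup>2) sums (W_norm lam phi s F)\<^sup>2"
proof -
  have "\<exists>g. Lpow_rep lam phi (s / 2) F g"
    using Lpow_rep_exists[OF assms] by blast
  from someI_ex[OF this] have "Lpow_rep lam phi (s / 2) F (SOME g. Lpow_rep lam phi (s / 2) F g)" .
  from Lpow_rep_imp(2)[OF this] show ?thesis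
    by (simp add: W_norm_def has_coeffs_phi[OF assms(1)])
qed

lemma W_L_I:
  assumes "has_coeffs F a" "summable (\<lambda>n. lam n powr s * (a n)\<^sup>2)"
  shows "W_L lam phi s F"
  using L_distr_has_coeffs[OF assms] Lpow_rep_exists[OF assms] by (auto simp: W_L_def)

lemma W_norm_nonneg: "W_norm lam phi s F \<ge> 0"
  by (simp add: W_norm_def L2_norm_nonneg)

lemma W_L_mono: "W_L lam phi s F \<Longrightarrow> r \<le> s \<Longrightarrow> W_L lam phi r F"
  by (metis W_L_I W_L_has_coeffs summable_weight_mono)

end

section \<open>The solution of the wave equation\<close>

context eigenbasis
begin

text \<open>Dominated convergence for the weighted series, in the form of Tannery's theorem. All
  continuity and differentiability claims in time reduce to it.\<close>

lemma W_norm_tendsto_0: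
  assumes coeffs: "\<forall>\<^sub>F s in \<F>. has_coeffs (G s) (c s)"
    and lim: "\<And>n. ((\<lambda>s. c s n) \<longlongrightarrow> 0) \<F>"
    and bound: "\<forall>\<^sub>F s in \<F>. \<forall>n. lam n powr r * (c s n)\<^sup>2 \<le> M n"
    and M: "summable M"
  shows "((\<lambda>s. W_norm lam phi r (G s)) \<longlongrightarrow> 0) \<F>"
proof (cases "\<F> = bot")
  case False
  define w where "w n s = lam n powr r * (c s n)\<^sup>2" for n s
  have "\<forall>\<^sub>F s in \<F>. \<forall>n. norm (w n s) \<le> M n"
    using bound by eventually_elim (simp add: w_def)
  \<comment> \<open>The domination holds for all indices at once, hence along the product filter
    that Tannery's theorem uses.\<close>
  then have "\<forall>\<^sub>F (m :: nat, s) in at_top \<times>\<^sub>F \<F>. \<forall>n. norm (w n s) \<le> M n"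
    by (subst eventually_prod2) auto
  then have ev: "\<forall>\<^sub>F (n, s) in at_top \<times>\<^sub>F \<F>. norm (w n s) \<le> M n"
    by (rule eventually_mono) auto
  have "((\<lambda>s. w n s) \<longlongrightarrow> 0) \<F>" for n
    unfolding w_def by (intro tendsto_mult_right_zero tendsto_null_power lim) simp
  from tannerys_theorem[OF this ev M False]
  have sums: "\<forall>\<^sub>F s in \<F>. summable (\<lambda>n. norm (w n s))" "((\<lambda>s. \<Sum>n. w n s) \<longlongrightarrow> (\<Sum>n. 0)) \<F>"
    by auto
  from tendsto_real_sqrt[OF sums(2)] have "((\<lambda>s. sqrt (\<Sum>n. w n s)) \<longlongrightarrow> 0) \<F>"
    by simp
  moreover have "\<forall>\<^sub>F s in \<F>. sqrt (\<Sum>n. w n s) = W_norm lam phi r (G s)"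
    using sums(1) coeffs
  proof eventually_elim
    case (elim s)
    have "(\<lambda>n. w n s) sums (W_norm lam phi r (G s))\<^sup>2"
      unfolding w_def using elim summable_norm_cancel[OF elim(1)] by (intro W_norm_sums) (auto simp: w_def)
    then show ?case
      by (simp add: sums_iff W_norm_nonneg)
  qed
  ultimately show ?thesis
    by (rule Lim_transform_eventually)
qed auto

end

locale wave_problem = eigenbasis +
  fixes T k :: real and u0 u1 :: "(real \<Rightarrow> real) \<Rightarrow> real"
  assumes T_pos: "T > 0" and u0: "W_L lam phi (1 + k) u0" and u1: "W_L lam phi k u1"
begin

section \<open>The oscillators in the single modes\<close>

definition alpha :: "nat \<Rightarrow> real \<Rightarrow> real" where
  "alpha n t = u0 (phi n) * cos (sqrt (lam n) * t) + u1 (phi n) * sin (sqrt (lam n) * t) / sqrt (lam n)"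

definition beta :: "nat \<Rightarrow> real \<Rightarrow> real" where
  "beta n t = u1 (phi n) * cos (sqrt (lam n) * t) - u0 (phi n) * sqrt (lam n) * sin (sqrt (lam n) * t)"

text \<open>A majorant independent of time for lam^r alpha^2 and for lam^(r-1) beta^2. The factor 2
  is that of (x + y)^2 <= 2 (x^2 + y^2).\<close>

definition data_bound :: "real \<Rightarrow> nat \<Rightarrow> real" where
  "data_bound r n = 2 * (lam n powr r * (u0 (phi n))\<^sup>2 + lam n powr (r - 1) * (u1 (phi n))\<^sup>2)"

lemma alpha_0: "alpha n 0 = u0 (phi n)" and beta_0: "beta n 0 = u1 (phi n)"
  by (simp_all add: alpha_def beta_def)

lemma alpha_derivative: "(alpha n has_real_derivative beta n t) (at t within S)"
proof -
  define w where "w = sqrt (lam n)"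
  have "w > 0" "lam n = w * w"
    using lam_pos[of n] by (simp_all add: w_def)
  then show ?thesis
    unfolding alpha_def[abs_def] beta_def w_def[symmetric]
    by (auto intro!: derivative_eq_intros simp: field_simps)
qed

lemma beta_derivative: "(beta n has_real_derivative (- lam n * alpha n t)) (at t within S)"
proof -
  define w where "w = sqrt (lam n)"
  have "w > 0" "lam n = w * w"
    using lam_pos[of n] by (simp_all add: w_def)
  then show ?thesis
    unfolding beta_def[abs_def] alpha_def w_def[symmetric]
    by (auto intro!: derivative_eq_intros simp: field_simps)
qed

lemma mult_bounded_square_le: "\<bar>y\<bar> \<le> 1 \<Longrightarrow> (x * y)\<^sup>2 \<le> x\<^sup>2" for x y :: real
  using abs_square_le_1[of y] mult_left_mono[of "y\<^sup>2" 1 "x\<^sup>2"] by (simp add: power_mult_distrib)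

lemma alpha_square_le: "(alpha n t)\<^sup>2 \<le> 2 * ((u0 (phi n))\<^sup>2 + (u1 (phi n))\<^sup>2 / lam n)"
proof -
  have "(alpha n t)\<^sup>2 \<le> 2 * ((u0 (phi n) * cos (sqrt (lam n) * t))\<^sup>2
      + (u1 (phi n) / sqrt (lam n) * sin (sqrt (lam n) * t))\<^sup>2)"
    using square_add_le[of "u0 (phi n) * cos (sqrt (lam n) * t)"
        "u1 (phi n) / sqrt (lam n) * sin (sqrt (lam n) * t)"]
    by (simp add: alpha_def)
  also have "\<dots> \<le> 2 * ((u0 (phi n))\<^sup>2 + (u1 (phi n) / sqrt (lam n))\<^sup>2)"
    by (intro mult_left_mono add_mono mult_bounded_square_le) auto
  finally show ?thesis
    using lam_pos[of n] by (simp add: power_divide)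
qed

lemma beta_square_le: "(beta n t)\<^sup>2 \<le> 2 * (lam n * (u0 (phi n))\<^sup>2 + (u1 (phi n))\<^sup>2)"
proof -
  have "(beta n t)\<^sup>2 \<le> 2 * ((u1 (phi n) * cos (sqrt (lam n) * t))\<^sup>2
      + (u0 (phi n) * sqrt (lam n) * sin (sqrt (lam n) * t))\<^sup>2)"
    unfolding beta_def by (rule square_diff_le)
  also have "\<dots> \<le> 2 * ((u1 (phi n))\<^sup>2 + (u0 (phi n) * sqrt (lam n))\<^sup>2)"
    by (intro mult_left_mono add_mono mult_bounded_square_le) auto
  finally show ?thesis
    using lam_pos[of n] by (simp add: power_mult_distrib algebra_simps)
qed

lemma lam_powr_diff_1: "lam n powr (r - 1) = lam n powr r / lam n"
  using lam_pos[of n] by (simp add: powr_diff)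

lemma alpha_bound: "lam n powr r * (alpha n t)\<^sup>2 \<le> data_bound r n"
  using mult_left_mono[OF alpha_square_le, of "lam n powr r" n t]
  by (simp add: data_bound_def lam_powr_diff_1 algebra_simps)

lemma beta_bound: "lam n powr (r - 1) * (beta n t)\<^sup>2 \<le> data_bound r n"
  using mult_left_mono[OF beta_square_le, of "lam n powr (r - 1)" n t] lam_pos[of n]
  by (simp add: data_bound_def lam_powr_diff_1 algebra_simps)

lemma weight_diff_bound:
  assumes "lam n powr r * x\<^sup>2 \<le> d" "lam n powr r * y\<^sup>2 \<le> d"
  shows "lam n powr r * (x - y)\<^sup>2 \<le> 4 * d"
  using mult_left_mono[OF square_diff_le, of "lam n powr r" x y] assms by (simp add: algebra_simps)

lemma data_bound_sums:
  assumes "W_L lam phi r u0" "W_L lam phi (r - 1) u1"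
  shows "data_bound r sums (2 * ((W_norm lam phi r u0)\<^sup>2 + (W_norm lam phi (r - 1) u1)\<^sup>2))"
  unfolding data_bound_def[abs_def]
  by (intro sums_mult sums_add W_norm_sums W_L_has_coeffs[OF assms(1)] W_L_has_coeffs[OF assms(2)])

lemma summable_data_bound: "summable (data_bound (1 + k))"
  using data_bound_sums[of "1 + k"] u0 u1 by (auto simp: sums_iff)

lemma summable_alpha: "summable (data_bound r) \<Longrightarrow> summable (\<lambda>n. lam n powr r * (alpha n t)\<^sup>2)"
  by (rule summable_comparison_test') (auto intro: alpha_bound)

lemma summable_beta: "summable (data_bound r) \<Longrightarrow> summable (\<lambda>n. lam n powr (r - 1) * (beta n t)\<^sup>2)"
  by (rule summable_comparison_test') (auto intro: beta_bound)

section \<open>The solution and its spectral estimates\<close>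

definition u :: "real \<Rightarrow> (real \<Rightarrow> real) \<Rightarrow> real" where
  "u t = series_distr (\<lambda>n. alpha n t)"

definition du :: "real \<Rightarrow> (real \<Rightarrow> real) \<Rightarrow> real" where
  "du t = series_distr (\<lambda>n. beta n t)"

lemma has_coeffs_u: "has_coeffs (u t) (\<lambda>n. alpha n t)"
  unfolding u_def by (rule has_coeffs_series_distr[OF summable_alpha[OF summable_data_bound]])

lemma has_coeffs_du: "has_coeffs (du t) (\<lambda>n. beta n t)"
  unfolding du_def by (rule has_coeffs_series_distr[OF summable_beta[OF summable_data_bound]])

text \<open>The index \<open>r\<close> is independent of \<open>k\<close>: r = 0, 1, 2 and r = k
  yield all bounds on \<open>u\<close> that the theorem needs.\<close>

lemma u_bound:
  assumes "W_L lam phi r u0" "W_L lam phi (r - 1) u1"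
  shows "W_L lam phi r (u t)"
    and "(W_norm lam phi r (u t))\<^sup>2 \<le> 2 * ((W_norm lam phi r u0)\<^sup>2 + (W_norm lam phi (r - 1) u1)\<^sup>2)"
proof -
  note bound = data_bound_sums[OF assms]
  then have sum: "summable (\<lambda>n. lam n powr r * (alpha n t)\<^sup>2)"
    by (intro summable_alpha) (simp add: sums_iff)
  show "W_L lam phi r (u t)"
    by (rule W_L_I[OF has_coeffs_u sum])
  show "(W_norm lam phi r (u t))\<^sup>2 \<le> 2 * ((W_norm lam phi r u0)\<^sup>2 + (W_norm lam phi (r - 1) u1)\<^sup>2)"
    by (rule sums_le[OF alpha_bound W_norm_sums[OF has_coeffs_u sum] bound])
qed

lemma du_bound:
  assumes "W_L lam phi r u0" "W_L lam phi (r - 1) u1"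
  shows "W_L lam phi (r - 1) (du t)"
    and "(W_norm lam phi (r - 1) (du t))\<^sup>2 \<le> 2 * ((W_norm lam phi r u0)\<^sup>2 + (W_norm lam phi (r - 1) u1)\<^sup>2)"
proof -
  note bound = data_bound_sums[OF assms]
  then have sum: "summable (\<lambda>n. lam n powr (r - 1) * (beta n t)\<^sup>2)"
    by (intro summable_beta) (simp add: sums_iff)
  show "W_L lam phi (r - 1) (du t)"
    by (rule W_L_I[OF has_coeffs_du sum])
  show "(W_norm lam phi (r - 1) (du t))\<^sup>2 \<le> 2 * ((W_norm lam phi r u0)\<^sup>2 + (W_norm lam phi (r - 1) u1)\<^sup>2)"
    by (rule sums_le[OF beta_bound W_norm_sums[OF has_coeffs_du sum] bound])
qed

lemma alpha_tendsto: "(alpha n \<longlongrightarrow> alpha n t) (at t within S)"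
  and beta_tendsto: "(beta n \<longlongrightarrow> beta n t) (at t within S)"
  using DERIV_continuous[OF alpha_derivative] DERIV_continuous[OF beta_derivative]
  by (simp_all add: continuous_within)

text \<open>Difference quotients are values of \<open>beta\<close>, so they obey the same
  time-independent majorant; this dominates the quotients in
  \<open>u_differentiable\<close>.\<close>

lemma alpha_mean_value:
  assumes "s \<noteq> t"
  obtains z where "(alpha n s - alpha n t) / (s - t) = beta n z"
proof (cases "s < t")
  case True
  from MVT2[OF this, of "alpha n" "beta n"] alpha_derivative
  obtain z where "alpha n t - alpha n s = (t - s) * beta n z" by blast
  with True that[of z] show ?thesis by (simp add: field_simps)
next
  case False
  with assms have "t < s" by simp
  from MVT2[OF this, of "alpha n" "beta n"] alpha_derivative
  obtain z where "alpha n s - alpha n t = (s - t) * beta n z" by blast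
  with \<open>t < s\<close> that[of z] show ?thesis by (simp add: field_simps)
qed

lemma u_continuous:
  "((\<lambda>s. W_norm lam phi (1 + k) (\<lambda>psi. u s psi - u t psi)) \<longlongrightarrow> 0) (at t within S)"
proof (rule W_norm_tendsto_0)
  show "\<forall>\<^sub>F s in at t within S. has_coeffs (\<lambda>psi. u s psi - u t psi) (\<lambda>n. alpha n s - alpha n t)"
    by (intro always_eventually allI has_coeffs_diff has_coeffs_u)
  show "((\<lambda>s. alpha n s - alpha n t) \<longlongrightarrow> 0) (at t within S)" for n
    by (intro LIM_zero alpha_tendsto)
  show "\<forall>\<^sub>F s in at t within S. \<forall>n. lam n powr (1 + k) * (alpha n s - alpha n t)\<^sup>2 \<le> 4 * data_bound (1 + k) n"
    by (intro always_eventually allI weight_diff_bound alpha_bound)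
  show "summable (\<lambda>n. 4 * data_bound (1 + k) n)"
    by (intro summable_mult summable_data_bound)
qed

lemma du_continuous:
  "((\<lambda>s. W_norm lam phi k (\<lambda>psi. du s psi - du t psi)) \<longlongrightarrow> 0) (at t within S)"
proof (rule W_norm_tendsto_0)
  show "\<forall>\<^sub>F s in at t within S. has_coeffs (\<lambda>psi. du s psi - du t psi) (\<lambda>n. beta n s - beta n t)"
    by (intro always_eventually allI has_coeffs_diff has_coeffs_du)
  show "((\<lambda>s. beta n s - beta n t) \<longlongrightarrow> 0) (at t within S)" for n
    by (intro LIM_zero beta_tendsto)
  show "\<forall>\<^sub>F s in at t within S. \<forall>n. lam n powr k * (beta n s - beta n t)\<^sup>2 \<le> 4 * data_bound (1 + k) n"
    using beta_bound[of _ "1 + k"] by (intro always_eventually allI weight_diff_bound) auto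
  show "summable (\<lambda>n. 4 * data_bound (1 + k) n)"
    by (intro summable_mult summable_data_bound)
qed

lemma u_differentiable:
  "((\<lambda>s. W_norm lam phi k (\<lambda>psi. (u s psi - u t psi) / (s - t) - du t psi)) \<longlongrightarrow> 0) (at t within S)"
proof (rule W_norm_tendsto_0)
  show "\<forall>\<^sub>F s in at t within S. has_coeffs (\<lambda>psi. (u s psi - u t psi) / (s - t) - du t psi)
      (\<lambda>n. (alpha n s - alpha n t) / (s - t) - beta n t)"
    by (intro always_eventually allI has_coeffs_diff has_coeffs_divide has_coeffs_u has_coeffs_du)
  show "((\<lambda>s. (alpha n s - alpha n t) / (s - t) - beta n t) \<longlongrightarrow> 0) (at t within S)" for n
    using alpha_derivative[of n t S] by (intro LIM_zero) (simp add: has_field_derivative_iff)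
  show "\<forall>\<^sub>F s in at t within S. \<forall>n.
      lam n powr k * ((alpha n s - alpha n t) / (s - t) - beta n t)\<^sup>2 \<le> 4 * data_bound (1 + k) n"
  \<comment> \<open>The mean value theorem requires s and t to differ, which the punctured filter
    supplies.\<close>
  proof (rule eventually_at_filter[THEN iffD2], intro always_eventually allI impI)
    fix s :: real and n :: nat assume "s \<noteq> t" "s \<in> S"
    obtain z where "(alpha n s - alpha n t) / (s - t) = beta n z"
      using alpha_mean_value[OF \<open>s \<noteq> t\<close>] .
    then show "lam n powr k * ((alpha n s - alpha n t) / (s - t) - beta n t)\<^sup>2 \<le> 4 * data_bound (1 + k) n"
      using beta_bound[of n "1 + k"] by (auto intro: weight_diff_bound)
  qed
  show "summable (\<lambda>n. 4 * data_bound (1 + k) n)"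
    by (intro summable_mult summable_data_bound)
qed

text \<open>The series of \<open>du\<close> tested against \<open>psi\<close> is differentiated term
  by term; rapid decay of the coefficients of \<open>psi\<close> makes the differentiated series
  converge uniformly in time.\<close>

lemma wave_equation:
  assumes psi: "test_fun lam phi psi" and chi: "test_fun lam phi chi"
    and L: "\<And>n. coeff phi chi n = lam n * coeff phi psi n" and t: "t \<in> {0..T}"
  shows "((\<lambda>s. du s psi) has_real_derivative - u t chi) (at t within {0..T})"
proof -
  define f' where "f' n s = - lam n * alpha n s * coeff phi psi n" for n s
  \<comment> \<open>The factor lam_n is split into lam^((1+k)/2) for alpha, as its W^(1+k) bound
    allows, and lam^((1-k)/2) for the test function.\<close>
  define M where "M n = data_bound (1 + k) n + lam n powr (1 - k) * (coeff phi psi n)\<^sup>2" for n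
  have "summable M"
    unfolding M_def using psi by (intro summable_add summable_data_bound) (simp add: test_fun_iff)
  have bound: "norm (f' n s) \<le> M n" for n s
  proof -
    define x where "x = lam n powr ((1 + k) / 2) * \<bar>alpha n s\<bar>"
    define y where "y = lam n powr ((1 - k) / 2) * \<bar>coeff phi psi n\<bar>"
    have "lam n powr ((1 + k) / 2) * lam n powr ((1 - k) / 2) = lam n"
      using lam_pos[of n] by (simp add: add_divide_distrib[symmetric] flip: powr_add)
    then have "norm (f' n s) = x * y"
      using lam_pos[of n] by (simp add: x_def y_def f'_def abs_mult)
    also have "\<dots> \<le> x\<^sup>2 + y\<^sup>2"
      using sum_squares_bound[of x y] zero_le_power2[of x] zero_le_power2[of y] by linarith
    also have "x\<^sup>2 = lam n powr (1 + k) * (alpha n s)\<^sup>2"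
      unfolding x_def power_mult_distrib lam_powr_square by (simp add: add_divide_distrib)
    also have "y\<^sup>2 = lam n powr (1 - k) * (coeff phi psi n)\<^sup>2"
      unfolding y_def power_mult_distrib lam_powr_square by (simp add: diff_divide_distrib)
    finally show ?thesis
      using alpha_bound[of n "1 + k" s] by (simp add: M_def)
  qed
  have sums: "(\<lambda>n. beta n s * coeff phi psi n) sums du s psi" for s
    using has_coeffs_du psi by (auto simp: has_coeffs_def)
  have "\<exists>g. \<forall>s\<in>{0..T}. (\<lambda>n. beta n s * coeff phi psi n) sums g s
      \<and> (g has_field_derivative (\<Sum>n. f' n s)) (at s within {0..T})"
  proof (rule has_field_derivative_series)
    show "((\<lambda>s. beta n s * coeff phi psi n) has_field_derivative f' n s) (at s within {0..T})" for n s
      unfolding f'_def by (intro DERIV_cmult_right beta_derivative)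
    show "uniform_limit {0..T} (\<lambda>n s. \<Sum>i<n. f' i s) (\<lambda>s. \<Sum>n. f' n s) sequentially"
      by (rule Weierstrass_m_test[OF bound \<open>summable M\<close>])
    show "summable (\<lambda>n. beta n 0 * coeff phi psi n)"
      using sums by (simp add: sums_iff)
  qed (use T_pos in auto)
  then obtain g where g: "\<And>s. s \<in> {0..T} \<Longrightarrow> (\<lambda>n. beta n s * coeff phi psi n) sums g s"
    "\<And>s. s \<in> {0..T} \<Longrightarrow> (g has_field_derivative (\<Sum>n. f' n s)) (at s within {0..T})"
    by blast
  have "(\<lambda>n. alpha n t * coeff phi chi n) sums u t chi"
    using has_coeffs_u chi by (auto simp: has_coeffs_def)
  then have "(\<lambda>n. f' n t) sums (- u t chi)"
    by (auto dest!: sums_minus simp: f'_def L mult_ac)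
  moreover have "(g has_field_derivative (\<Sum>n. f' n t)) (at t within {0..T})"
    using g t by blast
  ultimately have "(g has_field_derivative (- u t chi)) (at t within {0..T})"
    by (simp add: sums_iff)
  then show ?thesis
    by (rule has_field_derivative_transform_within[OF _ zero_less_one t]) (use sums_unique2[OF g(1) sums] in auto)
qed

lemma wave_solution_u: "wave_solution lam phi T k u0 u1 u du"
proof -
  have "distr_eq lam phi (u 0) u0"
    using has_coeffs_unique[OF _ W_L_has_coeffs(1)[OF u0]] has_coeffs_u[of 0] by (simp add: alpha_0)
  moreover have "distr_eq lam phi (du 0) u1"
    using has_coeffs_unique[OF _ W_L_has_coeffs(1)[OF u1]] has_coeffs_du[of 0] by (simp add: beta_0)
  ultimately show ?thesis
    unfolding wave_solution_def
    using u_bound(1)[of "1 + k"] du_bound(1)[of "1 + k"] u0 u1 u_continuous u_differentiable du_continuous wave_equation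
    by auto
qed

end

section \<open>Uniqueness and regularity\<close>

context eigenbasis
begin

text \<open>A single term is below the whole series. So each coefficient is continuous in the W^s
  norm, and limits in W^s descend to every mode.\<close>

lemma has_coeffs_le_W_norm:
  assumes "has_coeffs F a" "summable (\<lambda>n. lam n powr s * (a n)\<^sup>2)"
  shows "\<bar>a n\<bar> \<le> lam n powr (- s / 2) * W_norm lam phi s F"
proof -
  have "lam n powr s * (a n)\<^sup>2 \<le> (W_norm lam phi s F)\<^sup>2"
    using sum_le_suminf[of "\<lambda>n. lam n powr s * (a n)\<^sup>2" "{n}"] W_norm_sums[OF assms]
    by (auto simp: sums_iff)
  then have "(lam n powr (s / 2) * \<bar>a n\<bar>)\<^sup>2 \<le> (W_norm lam phi s F)\<^sup>2"
    by (simp add: power_mult_distrib lam_powr_square)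
  then have "lam n powr (s / 2) * \<bar>a n\<bar> \<le> W_norm lam phi s F"
    by (rule power2_le_imp_le[OF _ W_norm_nonneg])
  then have "lam n powr (- s / 2) * (lam n powr (s / 2) * \<bar>a n\<bar>) \<le> lam n powr (- s / 2) * W_norm lam phi s F"
    by (intro mult_left_mono) auto
  moreover have "lam n powr (- s / 2) * lam n powr (s / 2) = 1"
    using lam_pos[of n] by (simp flip: powr_add)
  ultimately show ?thesis
    by (simp flip: mult.assoc)
qed

lemma summable_weight_diff:
  assumes "summable (\<lambda>n. lam n powr s * (a n)\<^sup>2)" "summable (\<lambda>n. lam n powr s * (b n)\<^sup>2)"
  shows "summable (\<lambda>n. lam n powr s * (a n - b n)\<^sup>2)"
proof (rule summable_comparison_test')
  show "summable (\<lambda>n. 2 * (lam n powr s * (a n)\<^sup>2) + 2 * (lam n powr s * (b n)\<^sup>2))"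
    using assms by (intro summable_add summable_mult)
  from mult_left_mono[OF square_diff_le, of "lam n powr s" "a n" "b n" for n]
  show "norm (lam n powr s * (a n - b n)\<^sup>2) \<le> 2 * (lam n powr s * (a n)\<^sup>2) + 2 * (lam n powr s * (b n)\<^sup>2)" for n
    by (simp add: algebra_simps)
qed

end

context wave_problem
begin

lemma wave_solution_coeff_derivative:
  assumes sol: "wave_solution lam phi T k u0 u1 v dv" and t: "t \<in> {0..T}"
  shows "((\<lambda>s. v s (phi n)) has_real_derivative dv t (phi n)) (at t within {0..T})"
proof -
  define d where "d s m = (v s (phi m) - v t (phi m)) / (s - t) - dv t (phi m)" for s m
  have v: "W_L lam phi (1 + k) (v s)" "W_L lam phi k (dv s)" if "s \<in> {0..T}" for s
    using sol that by (auto simp: wave_solution_def)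
  have "\<bar>d s n\<bar> \<le> lam n powr (- k / 2) * W_norm lam phi k (\<lambda>psi. (v s psi - v t psi) / (s - t) - dv t psi)"
    if s: "s \<in> {0..T}" for s
  proof (rule has_coeffs_le_W_norm)
    show "has_coeffs (\<lambda>psi. (v s psi - v t psi) / (s - t) - dv t psi) (d s)"
      unfolding d_def[abs_def]
      by (intro has_coeffs_diff has_coeffs_divide W_L_has_coeffs(1)[OF v(1)] W_L_has_coeffs(1)[OF v(2)] s t)
    \<comment> \<open>The difference lies in W^(1+k) and must be lowered to W^k to be compared with
      \<open>dv t\<close>. For s = t the quotient below is division by zero, that is 0, and
      membership persists.\<close>
    have "summable (\<lambda>m. lam m powr k * (v s (phi m) - v t (phi m))\<^sup>2)"
      by (rule summable_weight_mono[of "1 + k"], rule summable_weight_diff)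
         (auto intro: W_L_has_coeffs(2)[OF v(1)] s t)
    then have "summable (\<lambda>m. (lam m powr k * (v s (phi m) - v t (phi m))\<^sup>2) / (s - t)\<^sup>2)"
      by (rule summable_divide)
    then show "summable (\<lambda>m. lam m powr k * (d s m)\<^sup>2)"
      unfolding d_def by (intro summable_weight_diff W_L_has_coeffs(2)[OF v(2)] t) (simp add: power_divide)
  qed
  then have ev: "\<forall>\<^sub>F s in at t within {0..T}. norm (d s n)
      \<le> lam n powr (- k / 2) * W_norm lam phi k (\<lambda>psi. (v s psi - v t psi) / (s - t) - dv t psi)"
    by (auto simp: eventually_at_filter)
  have "((\<lambda>s. W_norm lam phi k (\<lambda>psi. (v s psi - v t psi) / (s - t) - dv t psi)) \<longlongrightarrow> 0) (at t within {0..T})"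
    using sol t by (auto simp: wave_solution_def)
  then have "((\<lambda>s. d s n) \<longlongrightarrow> 0) (at t within {0..T})"
    by (intro Lim_null_comparison[OF ev] tendsto_mult_right_zero)
  then show ?thesis
    unfolding has_field_derivative_iff d_def by (rule LIM_zero_cancel)
qed

lemma wave_solution_coeff_derivative2:
  assumes sol: "wave_solution lam phi T k u0 u1 v dv" and t: "t \<in> {0..T}"
  shows "((\<lambda>s. dv s (phi n)) has_real_derivative - lam n * v t (phi n)) (at t within {0..T})"
proof -
  \<comment> \<open>The test function here is L applied to \<open>phi n\<close>.\<close>
  have "v t (\<lambda>x. lam n * phi n x) = lam n * v t (phi n)"
    using sol t by (intro has_coeffs_cmult_phi W_L_has_coeffs) (auto simp: wave_solution_def)
  moreover have "coeff phi (\<lambda>x. lam n * phi n x) m = lam m * coeff phi (phi n) m" for m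
    by (simp add: coeff_cmult coeff_phi)
  then have "((\<lambda>s. dv s (phi n)) has_real_derivative - v t (\<lambda>x. lam n * phi n x)) (at t within {0..T})"
    using sol t test_fun_phi test_fun_cmult_phi unfolding wave_solution_def by blast
  ultimately show ?thesis
    by simp
qed

text \<open>The energy \<open>(v\<^sub>n' - \<beta>\<^sub>n)\<^sup>2 + \<lambda>\<^sub>n (v\<^sub>n - \<alpha>\<^sub>n)\<^sup>2\<close> of the difference of two solutions is
  conserved in every mode and vanishes initially.\<close>

lemma wave_solution_unique:
  assumes sol: "wave_solution lam phi T k u0 u1 v dv" and t: "t \<in> {0..T}"
  shows "distr_eq lam phi (v t) (u t)"
proof -
  have "v t (phi n) = alpha n t" for n
  proof -
    define E where "E s = (dv s (phi n) - beta n s)\<^sup>2 + lam n * (v s (phi n) - alpha n s)\<^sup>2" for s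
    have "(E has_real_derivative 0) (at s within {0..T})" if "s \<in> {0..T}" for s
      unfolding E_def
      by (rule derivative_eq_intros wave_solution_coeff_derivative[OF sol that]
          wave_solution_coeff_derivative2[OF sol that] alpha_derivative beta_derivative refl
         | simp add: algebra_simps)+
    then obtain c where c: "\<And>s. s \<in> {0..T} \<Longrightarrow> E s = c"
      using has_field_derivative_zero_constant[of "{0..T}" E] by auto
    have "distr_eq lam phi (v 0) u0" "distr_eq lam phi (dv 0) u1"
      using sol by (auto simp: wave_solution_def)
    then have "E 0 = 0"
      by (simp add: E_def distr_eq_def test_fun_phi alpha_0 beta_0)
    then have "E t = 0"
      using c[of 0] c[OF t] T_pos by simp
    then have "lam n * (v t (phi n) - alpha n t)\<^sup>2 = 0"
      using lam_pos[of n] by (simp add: E_def add_nonneg_eq_0_iff)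
    then show ?thesis
      using lam_pos[of n] by simp
  qed
  moreover have "has_coeffs (v t) (\<lambda>n. v t (phi n))"
    using sol t by (intro W_L_has_coeffs[of "1 + k"]) (auto simp: wave_solution_def)
  ultimately show ?thesis
    using has_coeffs_unique has_coeffs_u by simp
qed

end

context eigenbasis
begin

section \<open>Weak derivatives of elements of W^1 and W^2\<close>

lemma has_coeffs_L2_inner:
  assumes "has_coeffs F a" "sq_int w" "\<And>n. coeff phi w n = a n" "test_fun lam phi psi"
  shows "F psi = L2_inner w psi"
  using assms parseval_inner[of w psi] by (auto simp: has_coeffs_def test_fun_def intro: sums_unique2)

lemma primitive_comb_diff_le:
  assumes "sq_int dw"
  shows "L2_norm (\<lambda>x. comb S a x - primitive dw x) \<le> L2_norm (\<lambda>x. dcomb S a x - dw x)"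
proof (rule L2_norm_le_bound)
  show "sq_int (\<lambda>x. comb S a x - primitive dw x)"
    by (intro sq_int_diff sq_int_comb sq_int_primitive assms)
  show "\<bar>comb S a x - primitive dw x\<bar> \<le> L2_norm (\<lambda>x. dcomb S a x - dw x)" if "x \<in> {0..1}" for x
    using primitive_le_L2_norm[OF sq_int_diff[OF sq_int_dcomb assms] that, of S a] that
    by (simp add: primitive_diff sq_int_dcomb assms comb_primitive)
qed

text \<open>The derivative is built first, as the L^2 limit of the derivatives of the partial sums.
  Its primitive is then absolutely continuous by construction, and its coefficients identify it with
  F.\<close>

lemma weak_derivative_exists:
  assumes F: "has_coeffs F a" and a: "summable (\<lambda>n. lam n powr 1 * (a n)\<^sup>2)"
    and nu: "Linf nu" "AE x in lborel. x \<in> {0..1} \<longrightarrow> nu x = c + (LINT s:{0..x}|lborel. q s)"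
  obtains w dw where "sq_int w" "\<And>psi. test_fun lam phi psi \<Longrightarrow> F psi = L2_inner w psi"
    "\<And>x. x \<in> {0..1} \<Longrightarrow> w x = w 0 + primitive dw x" "sq_int dw"
    "(L2_norm dw)\<^sup>2 \<le> 2 * (W_norm lam phi 1 F)\<^sup>2 + 4 * (Linf_norm nu)\<^sup>2 * (W_norm lam phi 0 F)\<^sup>2"
proof -
  \<comment> \<open>The terms of \<open>gradient_bound\<close>: they control the blocks, and their
    sum is the asserted bound.\<close>
  define b where "b n = 2 * (lam n * (a n)\<^sup>2) + 4 * (Linf_norm nu)\<^sup>2 * (a n)\<^sup>2" for n
  have a0: "summable (\<lambda>n. lam n powr 0 * (a n)\<^sup>2)"
    by (rule summable_weight_mono[OF a]) simp
  have b_eq: "b n = 2 * (lam n powr 1 * (a n)\<^sup>2) + 4 * (Linf_norm nu)\<^sup>2 * (lam n powr 0 * (a n)\<^sup>2)" for n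
    using lam_pos[of n] by (simp add: b_def)
  have b: "b sums (2 * (W_norm lam phi 1 F)\<^sup>2 + 4 * (Linf_norm nu)\<^sup>2 * (W_norm lam phi 0 F)\<^sup>2)"
    unfolding b_eq[abs_def] by (intro sums_add sums_mult W_norm_sums F a a0)
  have b_nonneg: "b n \<ge> 0" for n
    using lam_pos[of n] by (simp add: b_def)
  obtain dw where dw: "sq_int dw" "(\<lambda>N. L2_norm (\<lambda>x. (\<Sum>n<N. a n * dphi n x) - dw x)) \<longlonglongrightarrow> 0"
  proof (rule L2_series_converges)
    show "(L2_norm (\<lambda>x. \<Sum>i=m..<n. a i * dphi i x))\<^sup>2 \<le> (\<Sum>i=m..<n. b i)" for m n
      using gradient_bound[OF nu, of "{m..<n}" a] by (simp add: dcomb_def[abs_def] b_def)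
  qed (use b in \<open>auto simp: sums_iff intro: sq_int_cmult sq_int_dphi\<close>)
  then have lim: "(\<lambda>N. L2_norm (\<lambda>x. dcomb {..<N} a x - dw x)) \<longlonglongrightarrow> 0"
    by (simp add: dcomb_def)
  have w: "sq_int (primitive dw)"
    by (rule sq_int_primitive[OF dw(1)])
  have "(\<lambda>N. L2_norm (\<lambda>x. comb {..<N} a x - primitive dw x)) \<longlonglongrightarrow> 0"
    using primitive_comb_diff_le[OF dw(1)] by (intro Lim_null_comparison[OF _ lim]) (simp add: L2_norm_nonneg)
  then have coeff: "coeff phi (primitive dw) n = a n" for n
    by (rule coeff_comb_limit[OF w])
  have "(L2_norm dw)\<^sup>2 \<le> 2 * (W_norm lam phi 1 F)\<^sup>2 + 4 * (Linf_norm nu)\<^sup>2 * (W_norm lam phi 0 F)\<^sup>2"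
  proof (rule LIMSEQ_le_const2)
    show "(\<lambda>N. (L2_norm (dcomb {..<N} a))\<^sup>2) \<longlonglongrightarrow> (L2_norm dw)\<^sup>2"
      by (intro tendsto_power L2_norm_tendsto sq_int_dcomb dw lim)
    have "(L2_norm (dcomb {..<N} a))\<^sup>2 \<le> (\<Sum>n<N. b n)" for N
      using gradient_bound[OF nu, of "{..<N}" a] by (simp add: b_def)
    also have "(\<Sum>n<N. b n) \<le> 2 * (W_norm lam phi 1 F)\<^sup>2 + 4 * (Linf_norm nu)\<^sup>2 * (W_norm lam phi 0 F)\<^sup>2" for N
      using sum_le_suminf[of b "{..<N}"] b b_nonneg by (auto simp: sums_iff)
    finally show "\<exists>N. \<forall>n\<ge>N. (L2_norm (dcomb {..<n} a))\<^sup>2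
      \<le> 2 * (W_norm lam phi 1 F)\<^sup>2 + 4 * (Linf_norm nu)\<^sup>2 * (W_norm lam phi 0 F)\<^sup>2"
      by blast
  qed
  then show ?thesis
    by (intro that[OF w has_coeffs_L2_inner[OF F w coeff] _ dw(1)]) (simp_all add: primitive_0)
qed

lemma L2_norm_primitive_le: "sq_int f \<Longrightarrow> L2_norm (primitive f) \<le> L2_norm f"
  by (intro L2_norm_le_bound sq_int_primitive primitive_le_L2_norm)

text \<open>The identity w'' = q w - L w for finite combinations, integrated once.\<close>

lemma dcomb_primitive:
  assumes x: "x \<in> {0..1}"
  shows "dcomb S a x = dcomb S a 0 + primitive (\<lambda>s. q s * comb S a s - comb S (\<lambda>n. lam n * a n) s) x"
proof -
  have int: "sq_int (\<lambda>s. (q s - lam n) * phi n s)" for n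
    using sq_int_diff[OF sq_int_Linf_mult[OF Linf_q sq_int_phi] sq_int_cmult[OF sq_int_phi], of n "lam n" n]
    by (simp add: left_diff_distrib)
  have "dcomb S a x = (\<Sum>n\<in>S. a n * (dphi n 0 + primitive (\<lambda>s. (q s - lam n) * phi n s) x))"
    by (simp only: dcomb_def dphi_primitive[OF x])
  also have "\<dots> = dcomb S a 0 + primitive (\<lambda>s. \<Sum>n\<in>S. a n * ((q s - lam n) * phi n s)) x"
    using x by (subst primitive_sum)
      (auto simp: dcomb_def distrib_left sum.distrib primitive_cmult sq_int_cmult int)
  also have "(\<lambda>s. \<Sum>n\<in>S. a n * ((q s - lam n) * phi n s))
      = (\<lambda>s. q s * comb S a s - comb S (\<lambda>n. lam n * a n) s)"
    by (simp add: comb_def sum_distrib_left fun_eq_iff algebra_simps flip: sum_subtractf)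
  finally show ?thesis .
qed

text \<open>Since \<open>w\<close> vanishes at both ends, \<open>w'\<close> has mean zero, which determines \<open>w' 0\<close> from \<open>w''\<close>.\<close>

lemma second_weak_derivative_exists:
  assumes F: "has_coeffs F a" and a: "summable (\<lambda>n. lam n powr 2 * (a n)\<^sup>2)"
  obtains w dw ddw where "sq_int w" "\<And>psi. test_fun lam phi psi \<Longrightarrow> F psi = L2_inner w psi"
    "\<And>x. x \<in> {0..1} \<Longrightarrow> w x = w 0 + primitive dw x"
    "\<And>x. x \<in> {0..1} \<Longrightarrow> dw x = dw 0 + primitive ddw x" "sq_int ddw"
    "(L2_norm ddw)\<^sup>2 \<le> 2 * ((Linf_norm q)\<^sup>2 * (W_norm lam phi 0 F)\<^sup>2 + (W_norm lam phi 2 F)\<^sup>2)"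
proof -
  have a0: "summable (\<lambda>n. lam n powr 0 * (a n)\<^sup>2)"
    by (rule summable_weight_mono[OF a]) simp
  have sq0: "(a n)\<^sup>2 = lam n powr 0 * (a n)\<^sup>2" for n
    using lam_pos[of n] by simp
  have sq2: "(lam n * a n)\<^sup>2 = lam n powr 2 * (a n)\<^sup>2" for n
    using lam_pos[of n] by (simp add: power_mult_distrib powr_numeral)
  obtain f where f: "sq_int f" "\<And>n. coeff phi f n = a n"
    "(\<lambda>N. L2_norm (\<lambda>x. comb {..<N} a x - f x)) \<longlonglongrightarrow> 0"
    by (rule comb_converges[of a]) (use a0 in \<open>auto simp only: sq0[symmetric]\<close>)
  obtain g where g: "sq_int g" "\<And>n. coeff phi g n = lam n * a n"
    "(\<lambda>N. L2_norm (\<lambda>x. comb {..<N} (\<lambda>n. lam n * a n) x - g x)) \<longlonglongrightarrow> 0"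
    by (rule comb_converges[of "\<lambda>n. lam n * a n"]) (use a in \<open>auto simp only: sq2\<close>)
  \<comment> \<open>Here \<open>f\<close> represents F and \<open>g\<close> represents L F, so this
    is the candidate for w''.\<close>
  define ddw where "ddw x = q x * f x - g x" for x
  have qf: "sq_int (\<lambda>x. q x * f x)"
    by (intro sq_int_Linf_mult Linf_q f)
  have ddw: "sq_int ddw"
    unfolding ddw_def[abs_def] by (intro sq_int_diff qf g)
  define d0 where "d0 = - primitive (primitive ddw) 1"
  define dw where "dw x = d0 + primitive ddw x" for x
  have dw: "sq_int dw"
    unfolding dw_def[abs_def] by (intro sq_int_add sq_int_const sq_int_primitive ddw)
  have w: "sq_int (primitive dw)"
    by (rule sq_int_primitive[OF dw])
  \<comment> \<open>The second derivative of the partial sum.\<close>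
  define h where "h N x = (q x * comb {..<N} a x - comb {..<N} (\<lambda>n. lam n * a n) x)" for N x
  have h: "sq_int (h N)" for N
    unfolding h_def[abs_def] by (intro sq_int_diff sq_int_Linf_mult Linf_q sq_int_comb)
  have h_lim: "(\<lambda>N. L2_norm (\<lambda>x. h N x - ddw x)) \<longlonglongrightarrow> 0"
  proof (rule Lim_null_comparison)
    show "(\<lambda>N. Linf_norm q * L2_norm (\<lambda>x. comb {..<N} a x - f x)
        + L2_norm (\<lambda>x. comb {..<N} (\<lambda>n. lam n * a n) x - g x)) \<longlonglongrightarrow> 0"
      using tendsto_add[OF tendsto_mult_right_zero[OF f(3), of "Linf_norm q"] g(3)] by simp
    show "\<forall>\<^sub>F N in sequentially. norm (L2_norm (\<lambda>x. h N x - ddw x)) \<le> Linf_norm q * L2_norm (\<lambda>x. comb {..<N} a x - f x)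
        + L2_norm (\<lambda>x. comb {..<N} (\<lambda>n. lam n * a n) x - g x)"
    proof (intro always_eventually allI)
      fix N
      define p where "p x = comb {..<N} a x - f x" for x
      define r where "r x = comb {..<N} (\<lambda>n. lam n * a n) x - g x" for x
      have p: "sq_int p" and r: "sq_int r"
        unfolding p_def[abs_def] r_def[abs_def] by (intro sq_int_diff sq_int_comb f g)+
      have "(\<lambda>x. h N x - ddw x) = (\<lambda>x. q x * p x + (- 1) * r x)"
        by (simp add: h_def ddw_def p_def r_def fun_eq_iff algebra_simps)
      moreover have "L2_norm (\<lambda>x. q x * p x + (- 1) * r x) \<le> L2_norm (\<lambda>x. q x * p x) + L2_norm (\<lambda>x. (- 1) * r x)"
        by (intro L2_norm_triangle sq_int_Linf_mult Linf_q p sq_int_cmult r)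
      moreover have "L2_norm (\<lambda>x. q x * p x) \<le> Linf_norm q * L2_norm p"
        by (intro L2_norm_Linf_mult Linf_q p)
      ultimately show "norm (L2_norm (\<lambda>x. h N x - ddw x)) \<le> Linf_norm q * L2_norm (\<lambda>x. comb {..<N} a x - f x)
        + L2_norm (\<lambda>x. comb {..<N} (\<lambda>n. lam n * a n) x - g x)"
        by (simp only: L2_norm_cmult p_def[symmetric] r_def[symmetric]) (simp add: L2_norm_nonneg)
    qed
  qed
  \<comment> \<open>The factor 2 counts two errors, each at most the L^2 error of the second
    derivatives: that of the primitive and that of the initial slope.\<close>
  have bound: "L2_norm (\<lambda>x. dcomb {..<N} a x - dw x) \<le> 2 * L2_norm (\<lambda>x. h N x - ddw x)" for N
  proof (rule L2_norm_le_bound)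
    show "sq_int (\<lambda>x. dcomb {..<N} a x - dw x)"
      by (intro sq_int_diff sq_int_dcomb dw)
    define e where "e = (\<lambda>x. h N x - ddw x)"
    have e: "sq_int e"
      unfolding e_def by (intro sq_int_diff h ddw)
    have d: "dcomb {..<N} a x = dcomb {..<N} a 0 + primitive (h N) x" if "x \<in> {0..1}" for x
      using dcomb_primitive[OF that, of "{..<N}" a] by (simp add: h_def[abs_def])
    \<comment> \<open>The partial sums vanish at 1, so their initial slope obeys the formula that
      defines \<open>d0\<close>.\<close>
    have "0 = primitive (dcomb {..<N} a) 1"
      using comb_primitive[of 1 "{..<N}" a] comb_1 by simp
    also have "\<dots> = primitive (\<lambda>x. dcomb {..<N} a 0 + primitive (h N) x) 1"
      by (rule primitive_cong[OF d]) auto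
    also have "\<dots> = dcomb {..<N} a 0 + primitive (primitive (h N)) 1"
      by (subst primitive_add) (auto simp: sq_int_const sq_int_primitive h,
        simp add: primitive_1 measure_restrict_space space_restrict_space)
    finally have d0: "dcomb {..<N} a 0 = - primitive (primitive (h N)) 1"
      by simp
    fix x :: real assume x: "x \<in> {0..1}"
    have "dcomb {..<N} a x - dw x = primitive e x - (primitive (primitive (h N)) 1 - primitive (primitive ddw) 1)"
      unfolding d[OF x] d0 dw_def d0_def e_def using x by (simp add: primitive_diff h ddw)
    also have "primitive (primitive (h N)) 1 - primitive (primitive ddw) 1 = primitive (primitive e) 1"
    proof -
      have "primitive (primitive e) 1 = primitive (\<lambda>s. primitive (h N) s - primitive ddw s) 1"
        unfolding e_def by (rule primitive_cong) (simp_all add: primitive_diff h ddw)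
      then show ?thesis
        by (simp add: primitive_diff sq_int_primitive h ddw)
    qed
    finally have "\<bar>dcomb {..<N} a x - dw x\<bar> \<le> \<bar>primitive e x\<bar> + \<bar>primitive (primitive e) 1\<bar>"
      by simp
    also have "\<dots> \<le> L2_norm e + L2_norm e"
      using primitive_le_L2_norm[OF e x] primitive_le_L2_norm[OF sq_int_primitive[OF e], of 1]
        L2_norm_primitive_le[OF e] by simp
    finally show "\<bar>dcomb {..<N} a x - dw x\<bar> \<le> 2 * L2_norm (\<lambda>x. h N x - ddw x)"
      by (simp add: e_def)
  qed
  have "(\<lambda>N. L2_norm (\<lambda>x. comb {..<N} a x - primitive dw x)) \<longlonglongrightarrow> 0"
  proof (rule Lim_null_comparison)
    show "\<forall>\<^sub>F N in sequentially. norm (L2_norm (\<lambda>x. comb {..<N} a x - primitive dw x)) \<le> 2 * L2_norm (\<lambda>x. h N x - ddw x)"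
      using order_trans[OF primitive_comb_diff_le[OF dw] bound] by (simp add: L2_norm_nonneg)
    show "(\<lambda>N. 2 * L2_norm (\<lambda>x. h N x - ddw x)) \<longlonglongrightarrow> 0"
      by (rule tendsto_mult_right_zero[OF h_lim])
  qed
  then have coeff: "coeff phi (primitive dw) n = a n" for n
    by (rule coeff_comb_limit[OF w])
  have "(L2_norm f)\<^sup>2 = (W_norm lam phi 0 F)\<^sup>2"
    using parseval[OF f(1)] W_norm_sums[OF F a0] unfolding f(2) sq0[symmetric] by (rule sums_unique2)
  moreover have "(L2_norm g)\<^sup>2 = (W_norm lam phi 2 F)\<^sup>2"
    using parseval[OF g(1)] W_norm_sums[OF F a] unfolding g(2) sq2[symmetric] by (rule sums_unique2)
  moreover have "(L2_norm ddw)\<^sup>2 \<le> 2 * ((Linf_norm q)\<^sup>2 * (L2_norm f)\<^sup>2 + (L2_norm g)\<^sup>2)"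
  proof -
    have "L2_norm ddw \<le> L2_norm (\<lambda>x. q x * f x) + L2_norm g"
      using L2_norm_triangle[OF qf sq_int_cmult[OF g(1), of "- 1"]] L2_norm_cmult[of "- 1" g]
      by (simp add: ddw_def[abs_def])
    also have "\<dots> \<le> Linf_norm q * L2_norm f + L2_norm g"
      using L2_norm_Linf_mult[OF Linf_q f(1)] by simp
    finally have "(L2_norm ddw)\<^sup>2 \<le> (Linf_norm q * L2_norm f + L2_norm g)\<^sup>2"
      by (rule power_mono[OF _ L2_norm_nonneg])
    also have "\<dots> \<le> 2 * ((Linf_norm q * L2_norm f)\<^sup>2 + (L2_norm g)\<^sup>2)"
      using zero_le_power2[of "Linf_norm q * L2_norm f - L2_norm g"]
      by (simp add: power2_eq_square algebra_simps)
    finally show ?thesis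
      by (simp add: power_mult_distrib)
  qed
  ultimately show ?thesis
    by (intro that[OF w has_coeffs_L2_inner[OF F w coeff] _ _ ddw, of dw]) (simp_all add: primitive_0 dw_def)
qed

end

theorem theorem1:
  fixes T k :: real
  assumes "T > 0"
  shows "\<exists>C>0. \<forall>(q::real \<Rightarrow> real) (\<nu>::real \<Rightarrow> real) (lam::nat \<Rightarrow> real) (phi::nat \<Rightarrow> real \<Rightarrow> real)
            (u0::(real \<Rightarrow> real) \<Rightarrow> real) (u1::(real \<Rightarrow> real) \<Rightarrow> real).
     Linf q \<and> Linf \<nu>
     \<and> (\<exists>c. AE x in lborel. x \<in> {0..1} \<longrightarrow> \<nu> x = c + (LINT s:{0..x}|lborel. q s))
     \<and> eigen_ONB q lam phi \<and> (\<forall>n. lam n > 0)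
     \<and> W_L lam phi (1 + k) u0 \<and> W_L lam phi k u1
     \<longrightarrow>
     (\<exists>u du. wave_solution lam phi T k u0 u1 u du
        \<and> (\<forall>v dv. wave_solution lam phi T k u0 u1 v dv \<longrightarrow>
              (\<forall>t\<in>{0..T}. distr_eq lam phi (v t) (u t)))
        \<and> (\<forall>t\<in>{0..T}.
             (W_L lam phi 0 u0 \<and> W_L lam phi (-1) u1 \<longrightarrow>
                W_L lam phi 0 (u t)
                \<and> (W_norm lam phi 0 (u t))^2
                    \<le> C * ((W_norm lam phi 0 u0)^2 + (W_norm lam phi (-1) u1)^2))
           \<and> (W_L lam phi 1 u0 \<and> W_L lam phi 0 u1 \<longrightarrow>
                W_L lam phi 0 (du t)
                \<and> (W_norm lam phi 0 (du t))^2
                    \<le> C * ((W_norm lam phi 1 u0)^2 + (W_norm lam phi 0 u1)^2))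
           \<and> (W_L lam phi 1 u0 \<and> W_L lam phi 0 u1 \<longrightarrow>
                (\<exists>w dw. sq_int w \<and> (\<forall>psi. test_fun lam phi psi \<longrightarrow> u t psi = L2_inner w psi)
                   \<and> (\<forall>x\<in>{0..1}. w x = w 0 + (LINT s:{0..x}|lborel. dw s))
                   \<and> sq_int dw
                   \<and> (L2_norm dw)^2
                       \<le> C * ((1 + (L2_norm \<nu>)^2) * ((W_norm lam phi 1 u0)^2 + (W_norm lam phi 0 u1)^2)
                              + (Linf_norm \<nu>)^2 * ((W_norm lam phi 0 u0)^2 + (W_norm lam phi (-1) u1)^2))))
           \<and> (W_L lam phi 2 u0 \<and> W_L lam phi 1 u1 \<longrightarrow>
                (\<exists>w dw ddw. sq_int w \<and> (\<forall>psi. test_fun lam phi psi \<longrightarrow> u t psi = L2_inner w psi)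
                   \<and> (\<forall>x\<in>{0..1}. w x = w 0 + (LINT s:{0..x}|lborel. dw s))
                   \<and> (\<forall>x\<in>{0..1}. dw x = dw 0 + (LINT s:{0..x}|lborel. ddw s))
                   \<and> sq_int ddw
                   \<and> (L2_norm ddw)^2
                       \<le> C * ((Linf_norm q)^2 * ((W_norm lam phi 0 u0)^2 + (W_norm lam phi (-1) u1)^2)
                              + (W_norm lam phi 2 u0)^2 + (W_norm lam phi 1 u1)^2)))
           \<and> (W_norm lam phi k (u t))^2
                \<le> C * ((W_norm lam phi k u0)^2 + (W_norm lam phi (k - 1) u1)^2)))"
\<comment> \<open>8 = 4 * 2: the coefficient 4 of the nu term in \<open>gradient_bound\<close> times
  the factor 2 of \<open>u_bound\<close>. The other estimates have constants 2 or 4 and are relaxed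
  to it.\<close>
proof (rule exI[of _ 8], intro conjI allI impI, goal_cases)
  case (2 q nu lam phi u0 u1)
  then have q: "Linf q" and nu: "Linf nu" and basis: "eigen_ONB q lam phi" "\<forall>n. lam n > 0"
    and data: "W_L lam phi (1 + k) u0" "W_L lam phi k u1"
    by blast+
  from 2 obtain c where c: "AE x in lborel. x \<in> {0..1} \<longrightarrow> nu x = c + (LINT s:{0..x}|lborel. q s)"
    by blast
  interpret wave_problem q lam phi T k u0 u1
    by unfold_locales (use q basis data \<open>T > 0\<close> in auto)
  have est0: "W_L lam phi 0 (u t) \<and> (W_norm lam phi 0 (u t))\<^sup>2
      \<le> 2 * ((W_norm lam phi 0 u0)\<^sup>2 + (W_norm lam phi (-1) u1)\<^sup>2)"
    if "W_L lam phi 0 u0" "W_L lam phi (-1) u1" for t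
    using u_bound[of 0 t] that by simp
  have est1: "W_L lam phi 0 (du t) \<and> (W_norm lam phi 0 (du t))\<^sup>2
      \<le> 2 * ((W_norm lam phi 1 u0)\<^sup>2 + (W_norm lam phi 0 u1)\<^sup>2)"
    "W_L lam phi 1 (u t)" "(W_norm lam phi 1 (u t))\<^sup>2 \<le> 2 * ((W_norm lam phi 1 u0)\<^sup>2 + (W_norm lam phi 0 u1)\<^sup>2)"
    if "W_L lam phi 1 u0" "W_L lam phi 0 u1" for t
    using du_bound[of 1 t] u_bound[of 1 t] that by simp_all
  have summable: "summable (\<lambda>n. lam n powr r * (alpha n t)\<^sup>2)" if "W_L lam phi r (u t)" for r t
    using W_L_has_coeffs(2)[OF that] by (simp add: has_coeffs_phi[OF has_coeffs_u])
  have est2: "\<exists>w dw. sq_int w \<and> (\<forall>psi. test_fun lam phi psi \<longrightarrow> u t psi = L2_inner w psi)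
      \<and> (\<forall>x\<in>{0..1}. w x = w 0 + (LINT s:{0..x}|lborel. dw s)) \<and> sq_int dw
      \<and> (L2_norm dw)\<^sup>2 \<le> 8 * ((1 + (L2_norm nu)\<^sup>2) * ((W_norm lam phi 1 u0)\<^sup>2 + (W_norm lam phi 0 u1)\<^sup>2)
          + (Linf_norm nu)\<^sup>2 * ((W_norm lam phi 0 u0)\<^sup>2 + (W_norm lam phi (-1) u1)\<^sup>2))"
    if d: "W_L lam phi 1 u0" "W_L lam phi 0 u1" for t
  proof -
    obtain w dw where w: "sq_int w" "\<And>psi. test_fun lam phi psi \<Longrightarrow> u t psi = L2_inner w psi"
      "\<And>x. x \<in> {0..1} \<Longrightarrow> w x = w 0 + primitive dw x" "sq_int dw"
      and le: "(L2_norm dw)\<^sup>2 \<le> 2 * (W_norm lam phi 1 (u t))\<^sup>2 + 4 * (Linf_norm nu)\<^sup>2 * (W_norm lam phi 0 (u t))\<^sup>2"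
      using weak_derivative_exists[OF has_coeffs_u summable[OF est1(2)[OF d]] nu c] by blast
    define A where "A = (W_norm lam phi 1 u0)\<^sup>2 + (W_norm lam phi 0 u1)\<^sup>2"
    define B where "B = (W_norm lam phi 0 u0)\<^sup>2 + (W_norm lam phi (-1) u1)\<^sup>2"
    \<comment> \<open>By nesting, data in W^1 x W^0 also lie in W^0 x W^(-1), so the L^2 estimate of
      u(t) is available.\<close>
    have "(Linf_norm nu)\<^sup>2 * (W_norm lam phi 0 (u t))\<^sup>2 \<le> (Linf_norm nu)\<^sup>2 * (2 * B)"
      using est0[OF W_L_mono[OF d(1)] W_L_mono[OF d(2)]] unfolding B_def by (intro mult_left_mono) auto
    with le est1(3)[OF d, of t] have "(L2_norm dw)\<^sup>2 \<le> 4 * A + 8 * ((Linf_norm nu)\<^sup>2 * B)"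
      by (simp add: A_def)
    \<comment> \<open>\<open>A\<close> is nonnegative and the factor in front of it is at least
      1.\<close>
    also have "\<dots> \<le> 8 * ((1 + (L2_norm nu)\<^sup>2) * A + (Linf_norm nu)\<^sup>2 * B)"
      by (simp add: algebra_simps) (simp add: A_def)
    finally show ?thesis
      using w unfolding A_def B_def primitive_def by blast
  qed
  have est3: "\<exists>w dw ddw. sq_int w \<and> (\<forall>psi. test_fun lam phi psi \<longrightarrow> u t psi = L2_inner w psi)
      \<and> (\<forall>x\<in>{0..1}. w x = w 0 + (LINT s:{0..x}|lborel. dw s))
      \<and> (\<forall>x\<in>{0..1}. dw x = dw 0 + (LINT s:{0..x}|lborel. ddw s)) \<and> sq_int ddw
      \<and> (L2_norm ddw)\<^sup>2 \<le> 8 * ((Linf_norm q)\<^sup>2 * ((W_norm lam phi 0 u0)\<^sup>2 + (W_norm lam phi (-1) u1)\<^sup>2)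
          + (W_norm lam phi 2 u0)\<^sup>2 + (W_norm lam phi 1 u1)\<^sup>2)"
    if d: "W_L lam phi 2 u0" "W_L lam phi 1 u1" for t
  proof -
    have u2: "W_L lam phi 2 (u t)"
      "(W_norm lam phi 2 (u t))\<^sup>2 \<le> 2 * ((W_norm lam phi 2 u0)\<^sup>2 + (W_norm lam phi 1 u1)\<^sup>2)"
      using u_bound[of 2 t] d by simp_all
    obtain w dw ddw where w: "sq_int w" "\<And>psi. test_fun lam phi psi \<Longrightarrow> u t psi = L2_inner w psi"
      "\<And>x. x \<in> {0..1} \<Longrightarrow> w x = w 0 + primitive dw x"
      "\<And>x. x \<in> {0..1} \<Longrightarrow> dw x = dw 0 + primitive ddw x" "sq_int ddw"
      and le: "(L2_norm ddw)\<^sup>2 \<le> 2 * ((Linf_norm q)\<^sup>2 * (W_norm lam phi 0 (u t))\<^sup>2 + (W_norm lam phi 2 (u t))\<^sup>2)"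
      using second_weak_derivative_exists[OF has_coeffs_u summable[OF u2(1)]] by blast
    define B where "B = (W_norm lam phi 0 u0)\<^sup>2 + (W_norm lam phi (-1) u1)\<^sup>2"
    have "(Linf_norm q)\<^sup>2 * (W_norm lam phi 0 (u t))\<^sup>2 \<le> (Linf_norm q)\<^sup>2 * (2 * B)"
      using est0[OF W_L_mono[OF d(1)] W_L_mono[OF d(2)]] unfolding B_def by (intro mult_left_mono) auto
    with le u2(2) have "(L2_norm ddw)\<^sup>2
        \<le> 4 * ((Linf_norm q)\<^sup>2 * B + (W_norm lam phi 2 u0)\<^sup>2 + (W_norm lam phi 1 u1)\<^sup>2)"
      by (simp add: algebra_simps)
    also have "\<dots> \<le> 8 * ((Linf_norm q)\<^sup>2 * B + (W_norm lam phi 2 u0)\<^sup>2 + (W_norm lam phi 1 u1)\<^sup>2)"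
      by (intro mult_right_mono) (auto simp: B_def)
    finally show ?thesis
      using w unfolding B_def primitive_def by blast
  qed
  \<comment> \<open>Nesting places the given data in W^k x W^(k-1), so this estimate holds without
    further regularity.\<close>
  have est4: "(W_norm lam phi k (u t))\<^sup>2 \<le> 2 * ((W_norm lam phi k u0)\<^sup>2 + (W_norm lam phi (k - 1) u1)\<^sup>2)" for t
    using data by (intro u_bound) (auto intro: W_L_mono)
  have weaken: "x \<le> 8 * (a\<^sup>2 + b\<^sup>2)" if "x \<le> 2 * (a\<^sup>2 + b\<^sup>2)" for x a b :: real
    by (rule order_trans[OF that mult_right_mono]) simp_all
  show ?case
  proof (rule exI[of _ u], rule exI[of _ du], intro conjI allI impI ballI; (elim conjE)?)
  qed (use wave_solution_u wave_solution_unique est0 est1(1) est2 est3 est4 weaken in blast)+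
qed simp

end
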